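(* Fix $r\in(0,\infty)$. Let $(s_n)_{n\ge1}$ be a sequence of positive integers with $s_n\le n$ and $s_n/n\to0$ as $n\to\infty$. Then $$R_{\mathcal{L}}(\Theta_n[s_n])=\frac n2\log(1+r^{-1}),$$ $$R_{\mathcal{L}}(\Theta_n[s_n])/R_N(\Theta_n[s_n])\to\infty,$$ $$R_{\mathcal{G}}(\Theta_n[s_n])\sim R_{\mathcal{E}}(\Theta_n[s_n]),$$ where $a_n\sim b_n$ means $a_n/b_n\to1$ as $n\to\infty$.
   Context: Model: for $\theta\in\mathbb{R}^n$, the past observation $X\sim N_n(\theta,I)$ and the future observation $Y\sim N_n(\theta,rI)$ are independent given $\theta$; $r>0$ is known and fixed. Write $p(x|\theta,1)$ and $p(y|\theta,r)$ for their densities. A predictive density estimator is a measurable $\hat p(y|x)$ such that $\hat p(\cdot|x)$ is a probability density on $\mathbb{R}^n$ for each $x\in\mathbb{R}^n$. Its Kullback--Leibler loss is $L(\theta,\hat p(\cdot|x))=\int p(y|\theta,r)\log\frac{p(y|\theta,r)}{\hat p(y|x)}\,dy$ and its risk is $\rho(\theta,\hat p)=\int L(\theta,\hat p(\cdot|x))\,p(x|\theta,1)\,dx$. Parameter space: $\Theta_n[s]=\{\theta\in\mathbb{R}^n:\#\{i:\theta_i\ne0\}\le s\}$. Classes of estimators: - $\mathcal{E}$ (plug-in estimators): $\hat p(\cdot|x)$ is the $N_n(\hat\theta(x),rI)$ density for some measurable $\hat\theta:\mathbb{R}^n\to\mathbb{R}^n$. - $\mathcal{L}$ (linear estimators): $\hat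 p(\cdot|x)$ is the density of $\prod_{i=1}^nN(\alpha_ix_i,\alpha_i+r)$ for some constants $\alpha_i\in[0,1]$. - $\mathcal{G}$ (product Gaussian estimators): $\hat p(\cdot|x)$ is the density of $\prod_{i=1}^nN(\hat\theta_i,\hat d_i)$ for measurable functions $\hat\theta_i=\hat\theta_i(x)\in\mathbb{R}$ and $\hat d_i=\hat d_i(x)>0$; thus $\mathcal{L}\cup\mathcal{E}\subset\mathcal{G}$. Minimax risks: $R_{\mathcal{C}}(\Theta)=\inf_{\hat p\in\mathcal{C}}\sup_{\theta\in\Theta}\rho(\theta,\hat p)$ for $\mathcal{C}\in\{\mathcal{E},\mathcal{L},\mathcal{G}\}$, and $R_N(\Theta)=\inf_{\hat p}\sup_{\theta\in\Theta}\rho(\theta,\hat p)$ over all predictive density estimators. *)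

theory Defs
  imports "HOL-Probability.Probability"
begin

text \<open>
  The dimension \<open>n\<close> varies inside the statement, so \<open>\<real>\<^sup>n\<close> is the product space over the
  index set \<open>{..<n}\<close>: its points are the functions in \<open>{..<n} \<rightarrow>\<^sub>E UNIV\<close>, and its measure is
  Lebesgue measure on the Borel sets.
\<close>

definition Rn :: "nat \<Rightarrow> (nat \<Rightarrow> real) measure" where
  "Rn n = Pi\<^sub>M {..<n} (\<lambda>_. lborel)"

text \<open>
  Density of the product over \<open>i < n\<close> of the laws \<open>N(m i, v i)\<close>. Here \<open>v i\<close> is a variance,
  whereas \<^const>\<open>normal_density\<close> takes a standard deviation.
\<close>

definition prod_normal_density ::
  "nat \<Rightarrow> (nat \<Rightarrow> real) \<Rightarrow> (nat \<Rightarrow> real) \<Rightarrow> (nat \<Rightarrow> real) \<Rightarrow> real" where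
  "prod_normal_density n m v y = (\<Prod>i<n. normal_density (m i) (sqrt (v i)) (y i))"

definition gauss_density :: "nat \<Rightarrow> (nat \<Rightarrow> real) \<Rightarrow> real \<Rightarrow> (nat \<Rightarrow> real) \<Rightarrow> real" where
  "gauss_density n \<theta> v = prod_normal_density n \<theta> (\<lambda>_. v)"

text \<open>
  Lebesgue integral of an extended-real function as positive part minus negative part.
  The Bochner integral is not suitable for losses and risks, since it returns \<open>0\<close> where
  the value should be \<open>\<infinity>\<close>.
\<close>

definition ereal_integral :: "'a measure \<Rightarrow> ('a \<Rightarrow> ereal) \<Rightarrow> ereal" where
  "ereal_integral M f =
     enn2ereal (\<integral>\<^sup>+ x. e2ennreal (f x) \<partial>M) - enn2ereal (\<integral>\<^sup>+ x. e2ennreal (- f x) \<partial>M)"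

text \<open>
  Kullback--Leibler loss of a density \<open>q\<close>. The integrand is \<open>\<infinity>\<close> where \<open>q\<close> vanishes, because
  the Gaussian density is positive everywhere (in HOL, \<open>ln (p / 0) = 0\<close>). For a probability
  density \<open>q\<close> the negative part is integrable, by \<open>p * ln (p / q) \<ge> p - q\<close>, so no
  difference \<open>\<infinity> - \<infinity>\<close> arises.
\<close>

definition kl_loss :: "nat \<Rightarrow> real \<Rightarrow> (nat \<Rightarrow> real) \<Rightarrow> ((nat \<Rightarrow> real) \<Rightarrow> real) \<Rightarrow> ereal" where
  "kl_loss n r \<theta> q = ereal_integral (Rn n) (\<lambda>y.
     if q y = 0 then \<infinity>
     else ereal (gauss_density n \<theta> r y * ln (gauss_density n \<theta> r y / q y)))"

type_synonym estimator = "(nat \<Rightarrow> real) \<Rightarrow> (nat \<Rightarrow> real) \<Rightarrow> real"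

text \<open>For an estimator \<open>p\<close>, the value \<open>p x y\<close> is the predictive density at \<open>y\<close> given \<open>x\<close>.\<close>

definition kl_risk :: "nat \<Rightarrow> real \<Rightarrow> (nat \<Rightarrow> real) \<Rightarrow> estimator \<Rightarrow> ereal" where
  "kl_risk n r \<theta> p =
     ereal_integral (Rn n) (\<lambda>x. kl_loss n r \<theta> (p x) * ereal (gauss_density n \<theta> 1 x))"

definition sparse_space :: "nat \<Rightarrow> nat \<Rightarrow> (nat \<Rightarrow> real) set" where
  "sparse_space n s = {\<theta> \<in> space (Rn n). card {i \<in> {..<n}. \<theta> i \<noteq> 0} \<le> s}"

definition all_estimators :: "nat \<Rightarrow> estimator set" where
  "all_estimators n =
     {p. (\<lambda>(x, y). p x y) \<in> borel_measurable (Rn n \<Otimes>\<^sub>M Rn n) \<and>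
         (\<forall>x\<in>space (Rn n).
            (\<forall>y\<in>space (Rn n). 0 \<le> p x y) \<and> (\<integral>\<^sup>+ y. ennreal (p x y) \<partial>Rn n) = 1)}"

definition plugin_estimators :: "nat \<Rightarrow> real \<Rightarrow> estimator set" where
  "plugin_estimators n r =
     {p. \<exists>t \<in> Rn n \<rightarrow>\<^sub>M Rn n.
         \<forall>x\<in>space (Rn n). \<forall>y\<in>space (Rn n). p x y = gauss_density n (t x) r y}"

definition linear_estimators :: "nat \<Rightarrow> real \<Rightarrow> estimator set" where
  "linear_estimators n r =
     {p. \<exists>\<alpha>. (\<forall>i<n. \<alpha> i \<in> {0..1}) \<and>
         (\<forall>x\<in>space (Rn n). \<forall>y\<in>space (Rn n).
            p x y = prod_normal_density n (\<lambda>i. \<alpha> i * x i) (\<lambda>i. \<alpha> i + r) y)}"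

definition gaussian_estimators :: "nat \<Rightarrow> estimator set" where
  "gaussian_estimators n =
     {p. \<exists>t d. (\<forall>i<n. t i \<in> borel_measurable (Rn n)) \<and>
         (\<forall>i<n. d i \<in> borel_measurable (Rn n)) \<and>
         (\<forall>i<n. \<forall>x\<in>space (Rn n). 0 < d i x) \<and>
         (\<forall>x\<in>space (Rn n). \<forall>y\<in>space (Rn n).
            p x y = prod_normal_density n (\<lambda>i. t i x) (\<lambda>i. d i x) y)}"

definition minimax_risk ::
  "nat \<Rightarrow> real \<Rightarrow> estimator set \<Rightarrow> (nat \<Rightarrow> real) set \<Rightarrow> ereal" where
  "minimax_risk n r C \<Theta> = (INF p\<in>C. SUP \<theta>\<in>\<Theta>. kl_risk n r \<theta> p)"

abbreviation R_L :: "real \<Rightarrow> nat \<Rightarrow> (nat \<Rightarrow> real) set \<Rightarrow> ereal" where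
  "R_L r n \<equiv> minimax_risk n r (linear_estimators n r)"

abbreviation R_E :: "real \<Rightarrow> nat \<Rightarrow> (nat \<Rightarrow> real) set \<Rightarrow> ereal" where
  "R_E r n \<equiv> minimax_risk n r (plugin_estimators n r)"

abbreviation R_G :: "real \<Rightarrow> nat \<Rightarrow> (nat \<Rightarrow> real) set \<Rightarrow> ereal" where
  "R_G r n \<equiv> minimax_risk n r (gaussian_estimators n)"

abbreviation R_N :: "real \<Rightarrow> nat \<Rightarrow> (nat \<Rightarrow> real) set \<Rightarrow> ereal" where
  "R_N r n \<equiv> minimax_risk n r (all_estimators n)"

text \<open>
  Ratio of two minimax risks as a real number. It is \<open>0\<close> if either risk is \<open>0\<close> or infinite,
  so convergence of such ratios to \<open>\<infinity>\<close> or to \<open>1\<close> implies that both risks are eventually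
  finite and nonzero.
\<close>

definition risk_ratio :: "ereal \<Rightarrow> ereal \<Rightarrow> real" where
  "risk_ratio a b = real_of_ereal a / real_of_ereal b"

end

theory Submission
  imports Defs "HOL-Real_Asymp.Real_Asymp"
begin

text \<open>
  The Kullback--Leibler loss of a product Gaussian predictive density splits into a sum over the
  coordinates, with an explicit summand \<open>kl_normal\<close>; all risks in the classes of linear,
  plug-in and product Gaussian estimators therefore reduce to one-dimensional Gaussian integrals.

  Linear estimators. If some \<open>\<alpha>\<^sub>j < 1\<close>, the squared bias
  \<open>(1 - \<alpha>\<^sub>j)\<^sup>2 \<theta>\<^sub>j\<^sup>2\<close> is unbounded over the sparse vectors, as a single coordinate may
  be arbitrarily large. What remains is \<open>\<alpha> = 1\<close>, the uniform-prior rule, whose risk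
  is \<open>n/2 * ln (1 + 1/r)\<close> at every \<open>\<theta>\<close>. Sparsity does not help, and the risk is linear in \<open>n\<close>.

  Upper bound for plug-in rules. The plug-in risk is the mean squared error divided by \<open>2 r\<close>. Soft
  thresholding at \<open>sqrt (2 ln (n/s))\<close> has squared error at most \<open>2 s / n\<close> at a zero coordinate and
  \<open>(1 + sqrt (2 ln (n/s)))\<^sup>2\<close> at any other, so both \<open>R_E\<close> and \<open>R_N\<close> are at most
  \<open>(1 + o(1)) * s * ln (n/s) / r\<close>. This is \<open>o(n)\<close>, and the second claim follows once
  \<open>R_N > 0\<close> is known, which a two-point argument with the Hellinger distance gives.

  Lower bound for product Gaussian rules. A Gaussian rule can adapt its variance, and against a
  two-point posterior of variance \<open>V\<close> the best loss is \<open>ln (1 + V/r) / 2\<close> instead of the plug-in value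
  \<open>V / (2 r)\<close>. The two agree to first order if \<open>V\<close> is small. Hence a prior is needed for which
  the mean squared error is nearly minimax although the posterior variance of each coordinate is small
  even where there is a spike. Cut the coordinates into \<open>s\<close> blocks of size \<open>m = n div s\<close>; each
  block independently has no spike, with a small probability \<open>\<delta>\<close>, and otherwise one spike
  at a uniformly distributed position. Its height is slightly less than \<open>sqrt (2 ln m)\<close>,
  so that the observation at the spike does not stand out among the noise of the block, and the posterior
  probability of the true position still tends to \<open>0\<close>. The possibility of an empty block makes
  this quantitative through a single likelihood ratio: for each position, the spike there is compared
  with the empty block. Every block then costs
  \<open>(1 - o(1)) * ln m / r\<close>, whence \<open>R_G \<ge> (1 - o(1)) * s * ln (n/s) / r\<close>. Together with
  \<open>R_G \<le> R_E\<close> this gives the third claim.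
\<close>

section \<open>Gaussian densities on the product space\<close>

lemma measurable_Rn_component [measurable]:
  "i < n \<Longrightarrow> (\<lambda>x. x i) \<in> borel_measurable (Rn n)"
  unfolding Rn_def using measurable_component_singleton[of i "{..<n}" "\<lambda>_. lborel"] by simp

lemma prod_normal_density_nonneg [simp]: "0 \<le> prod_normal_density n m v y"
  by (simp add: prod_normal_density_def prod_nonneg)

lemma prod_normal_density_pos:
  "(\<And>i. i < n \<Longrightarrow> 0 < v i) \<Longrightarrow> 0 < prod_normal_density n m v y"
  unfolding prod_normal_density_def by (intro prod_pos) (auto intro!: normal_density_pos)

lemma gauss_density_nonneg [simp]: "0 \<le> gauss_density n \<theta> v y"
  by (simp add: gauss_density_def)

lemma gauss_density_pos: "0 < v \<Longrightarrow> 0 < gauss_density n \<theta> v y"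
  by (simp add: gauss_density_def prod_normal_density_pos)

lemma measurable_gauss_density [measurable]:
  "gauss_density n \<theta> v \<in> borel_measurable (Rn n)"
  unfolding gauss_density_def prod_normal_density_def by measurable

lemma gauss_density_split:
  "i < n \<Longrightarrow> gauss_density n \<theta> v x =
     normal_density (\<theta> i) (sqrt v) (x i) *
     (\<Prod>j\<in>{..<n}-{i}. normal_density (\<theta> j) (sqrt v) (x j))"
  unfolding gauss_density_def prod_normal_density_def by (rule prod.remove) auto

lemma nn_integral_normal_density:
  "0 < \<sigma> \<Longrightarrow> (\<integral>\<^sup>+ u. ennreal (normal_density m \<sigma> u) \<partial>lborel) = 1"
  by (subst nn_integral_eq_integral) auto

text \<open>
  Under the product Gaussian law the coordinate \<open>x i\<close> is normal: all other factors integrate to \<open>1\<close>.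
\<close>

lemma nn_integral_gauss_marginal:
  assumes "i < n" "0 < v" and f [measurable]: "f \<in> borel_measurable borel"
  shows "(\<integral>\<^sup>+ x. f (x i) * ennreal (gauss_density n \<theta> v x) \<partial>Rn n) =
    (\<integral>\<^sup>+ u. f u * ennreal (normal_density (\<theta> i) (sqrt v) u) \<partial>lborel)"
proof -
  interpret product_sigma_finite "\<lambda>_::nat. lborel :: real measure" ..
  let ?g = "\<lambda>j u. (if j = i then f u else 1) * ennreal (normal_density (\<theta> j) (sqrt v) u)"
  have "(\<integral>\<^sup>+ x. f (x i) * ennreal (gauss_density n \<theta> v x) \<partial>Rn n)
      = (\<integral>\<^sup>+ x. (\<Prod>j\<in>{..<n}. ?g j (x j)) \<partial>Rn n)"
  proof (rule nn_integral_cong)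
    fix x
    have "(\<Prod>j\<in>{..<n}. ?g j (x j)) =
      (\<Prod>j\<in>{..<n}. if j = i then f (x j) else 1) * ennreal (gauss_density n \<theta> v x)"
      unfolding gauss_density_def prod_normal_density_def prod.distrib
      by (simp add: prod_ennreal)
    also have "(\<Prod>j\<in>{..<n}. if j = i then f (x j) else 1) = f (x i)"
      using assms(1) by (subst prod.delta) auto
    finally show "f (x i) * ennreal (gauss_density n \<theta> v x) = (\<Prod>j\<in>{..<n}. ?g j (x j))" by simp
  qed
  also have "\<dots> = (\<Prod>j\<in>{..<n}. \<integral>\<^sup>+ u. ?g j u \<partial>lborel)"
    unfolding Rn_def by (rule product_nn_integral_prod) auto
  also have "\<dots> = (\<Prod>j\<in>{..<n}. if j = i then \<integral>\<^sup>+ u. f u * ennreal (normal_density (\<theta> i) (sqrt v) u) \<partial>lborel else 1)"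
    by (rule prod.cong) (use \<open>0 < v\<close> in \<open>auto simp: nn_integral_normal_density\<close>)
  also have "\<dots> = (\<integral>\<^sup>+ u. f u * ennreal (normal_density (\<theta> i) (sqrt v) u) \<partial>lborel)"
    using assms(1) by (subst prod.delta) auto
  finally show ?thesis .
qed

lemma nn_integral_gauss_density:
  assumes "0 < v"
  shows "(\<integral>\<^sup>+ x. ennreal (gauss_density n \<theta> v x) \<partial>Rn n) = 1"
proof -
  interpret product_sigma_finite "\<lambda>_::nat. lborel :: real measure" ..
  have "(\<integral>\<^sup>+ x. ennreal (gauss_density n \<theta> v x) \<partial>Rn n)
    = (\<integral>\<^sup>+ x. (\<Prod>j\<in>{..<n}. ennreal (normal_density (\<theta> j) (sqrt v) (x j))) \<partial>Rn n)"
    by (simp add: gauss_density_def prod_normal_density_def prod_ennreal)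
  also have "\<dots> = (\<Prod>j\<in>{..<n}. \<integral>\<^sup>+ u. ennreal (normal_density (\<theta> j) (sqrt v) u) \<partial>lborel)"
    unfolding Rn_def by (rule product_nn_integral_prod) auto
  finally show ?thesis using assms by (simp add: nn_integral_normal_density)
qed

lemma has_bochner_integral_gauss_marginal:
  fixes f :: "real \<Rightarrow> real"
  assumes i: "i < n" and "0 < v"
    and f: "has_bochner_integral lborel (\<lambda>u. normal_density (\<theta> i) (sqrt v) u * f u) c"
  shows "has_bochner_integral (Rn n) (\<lambda>x. gauss_density n \<theta> v x * f (x i)) c"
proof -
  interpret product_sigma_finite "\<lambda>_::nat. lborel :: real measure" ..
  let ?g = "\<lambda>j u. normal_density (\<theta> j) (sqrt v) u * (if j = i then f u else 1)"
  have eq: "(\<lambda>x. gauss_density n \<theta> v x * f (x i)) = (\<lambda>x. \<Prod>j\<in>{..<n}. ?g j (x j))"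
  proof
    fix x
    have "(\<Prod>j\<in>{..<n}. if j = i then f (x j) else 1) = f (x i)"
      using i by (subst prod.delta) auto
    then show "gauss_density n \<theta> v x * f (x i) = (\<Prod>j\<in>{..<n}. ?g j (x j))"
      unfolding gauss_density_def prod_normal_density_def prod.distrib by simp
  qed
  have int: "integrable lborel (?g j)" for j
    using f \<open>0 < v\<close> by (cases "j = i") (auto simp: has_bochner_integral_iff)
  have val: "integral\<^sup>L lborel (?g j) = (if j = i then c else 1)" for j
    using f \<open>0 < v\<close> by (cases "j = i") (auto simp: has_bochner_integral_iff)
  have "integral\<^sup>L (Rn n) (\<lambda>x. \<Prod>j\<in>{..<n}. ?g j (x j)) = (\<Prod>j\<in>{..<n}. integral\<^sup>L lborel (?g j))"
    unfolding Rn_def by (rule product_integral_prod) (auto intro: int)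
  also have "\<dots> = c" unfolding val using i by (subst prod.delta) auto
  finally show ?thesis
    unfolding eq has_bochner_integral_iff Rn_def
    by (auto intro!: product_integrable_prod int)
qed

lemma normal_quadratic_expectation:
  assumes "0 < \<sigma>"
  shows "has_bochner_integral lborel
    (\<lambda>u. normal_density m \<sigma> u * (a + b * (u - m) + c * (u - m)\<^sup>2)) (a + c * \<sigma>\<^sup>2)"
proof -
  have 0: "has_bochner_integral lborel (\<lambda>u. normal_density m \<sigma> u * a) a"
    using has_bochner_integral_mult_left[OF normal_moment_even[OF assms, of m 0], of a] by simp
  have 1: "has_bochner_integral lborel (\<lambda>u. normal_density m \<sigma> u * (u - m) * b) 0"
    using has_bochner_integral_mult_left[OF normal_moment_odd[OF assms, of m 0], of b] by simp
  have "has_bochner_integral lborel (\<lambda>u. normal_density m \<sigma> u * (u - m)\<^sup>2) (\<sigma>\<^sup>2)"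
    using normal_moment_even[OF assms, of m 1] by simp
  from has_bochner_integral_mult_left[OF this, of c]
  have 2: "has_bochner_integral lborel (\<lambda>u. normal_density m \<sigma> u * (u - m)\<^sup>2 * c) (\<sigma>\<^sup>2 * c)"
    by simp
  from has_bochner_integral_add[OF has_bochner_integral_add[OF 0 1] 2]
  show ?thesis by (simp add: algebra_simps)
qed

lemma ereal_integral_eq_integral:
  fixes f :: "'a \<Rightarrow> real"
  assumes "has_bochner_integral M f c"
  shows "ereal_integral M (\<lambda>x. ereal (f x)) = ereal c"
proof -
  have i: "integrable M f" and c: "integral\<^sup>L M f = c"
    using assms by (auto simp: has_bochner_integral_iff)
  obtain a b where ab: "0 \<le> a" "0 \<le> b" "(\<integral>\<^sup>+ x. ennreal (f x) \<partial>M) = ennreal a"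
    "(\<integral>\<^sup>+ x. ennreal (- f x) \<partial>M) = ennreal b" "c = a - b"
    using integrableE[OF i] c by metis
  then show ?thesis unfolding ereal_integral_def by (simp add: ennreal_def[symmetric] enn2ereal_ennreal)
qed

section \<open>Kullback--Leibler risk of product Gaussian estimators\<close>

text \<open>
  The divergence of \<open>N(t, d)\<close> from \<open>N(\<theta>, r)\<close>, where \<open>r\<close> and \<open>d\<close> are variances.
\<close>

definition kl_normal :: "real \<Rightarrow> real \<Rightarrow> real \<Rightarrow> real \<Rightarrow> real" where
  "kl_normal r \<theta> t d = (ln (d / r) + (r + (\<theta> - t)\<^sup>2) / d - 1) / 2"

lemma ln_add_inverse_ge_1: "0 < (u::real) \<Longrightarrow> 1 \<le> ln u + 1 / u"
  using ln_le_minus_one[of "1 / u"] by (simp add: ln_div)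

lemma kl_normal_ge:
  assumes "0 < r" "0 < d"
  shows "(\<theta> - t)\<^sup>2 / (2 * d) \<le> kl_normal r \<theta> t d"
proof -
  have "1 \<le> ln (d / r) + r / d"
    using ln_add_inverse_ge_1[of "d / r"] assms by simp
  then show ?thesis by (simp add: kl_normal_def add_divide_distrib diff_divide_distrib)
qed

lemma kl_normal_nonneg: "0 < r \<Longrightarrow> 0 < d \<Longrightarrow> 0 \<le> kl_normal r \<theta> t d"
  by (rule order_trans[OF _ kl_normal_ge]) auto

text \<open>
  The logarithm of the ratio of the two product densities is a sum of quadratic polynomials, one in
  each coordinate, so only the first two moments of the normal law enter.
\<close>

lemma kl_loss_prod_normal:
  assumes r: "0 < r" and d: "\<And>i. i < n \<Longrightarrow> 0 < d i"
  shows "kl_loss n r \<theta> (prod_normal_density n t d) = ereal (\<Sum>i<n. kl_normal r (\<theta> i) (t i) (d i))"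
proof -
  let ?q = "prod_normal_density n t d"
  define h where "h i u = ln (normal_density (\<theta> i) (sqrt r) u) - ln (normal_density (t i) (sqrt (d i)) u)" for i u
  have h_eq: "h i u = (ln (d i / r) / 2 + (\<theta> i - t i)\<^sup>2 / (2 * d i)) + ((\<theta> i - t i) / d i) * (u - \<theta> i)
      + (1 / (2 * d i) - 1 / (2 * r)) * (u - \<theta> i)\<^sup>2" if "i < n" for i u
  proof -
    have lnN: "ln (normal_density m (sqrt v) u) = - (ln (2 * pi) + ln v) / 2 - (u - m)\<^sup>2 / (2 * v)"
      if "0 < v" for m v
      using that by (simp add: normal_density_def ln_mult ln_div ln_sqrt add_divide_distrib)
    show ?thesis unfolding h_def lnN[OF r] lnN[OF d[OF that]] using r d[OF that]
      by (simp add: ln_div field_simps power2_eq_square)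
  qed
  have ln_eq: "ln (gauss_density n \<theta> r y / ?q y) = (\<Sum>i<n. h i (y i))" for y
  proof -
    have "ln (gauss_density n \<theta> r y) = (\<Sum>i<n. ln (normal_density (\<theta> i) (sqrt r) (y i)))"
      unfolding gauss_density_def prod_normal_density_def
      by (rule ln_prod) (simp, metis less_irrefl normal_density_pos r real_sqrt_gt_0_iff)
    moreover have "ln (?q y) = (\<Sum>i<n. ln (normal_density (t i) (sqrt (d i)) (y i)))"
      unfolding prod_normal_density_def by (rule ln_prod) (simp, metis d lessThan_iff less_irrefl normal_density_pos real_sqrt_gt_0_iff)
    ultimately show ?thesis
      using gauss_density_pos[OF r, of n \<theta> y] prod_normal_density_pos[of n d t y] d
      by (simp add: ln_div h_def sum_subtractf)
  qed
  have hb: "has_bochner_integral (Rn n) (\<lambda>y. gauss_density n \<theta> r y * h i (y i)) (kl_normal r (\<theta> i) (t i) (d i))"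
    if i: "i < n" for i
  proof (rule has_bochner_integral_gauss_marginal[OF i r])
    have "kl_normal r (\<theta> i) (t i) (d i) =
      (ln (d i / r) / 2 + (\<theta> i - t i)\<^sup>2 / (2 * d i)) + (1 / (2 * d i) - 1 / (2 * r)) * (sqrt r)\<^sup>2"
      using r d[OF i] by (simp add: kl_normal_def field_simps)
    then show "has_bochner_integral lborel (\<lambda>u. normal_density (\<theta> i) (sqrt r) u * h i u)
      (kl_normal r (\<theta> i) (t i) (d i))"
      unfolding h_eq[OF i] using r by (simp only:) (rule normal_quadratic_expectation, simp)
  qed
  have "has_bochner_integral (Rn n) (\<lambda>y. \<Sum>i<n. gauss_density n \<theta> r y * h i (y i))
     (\<Sum>i<n. kl_normal r (\<theta> i) (t i) (d i))"
    by (rule has_bochner_integral_sum) (use hb in auto)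
  then have "has_bochner_integral (Rn n) (\<lambda>y. gauss_density n \<theta> r y * ln (gauss_density n \<theta> r y / ?q y))
     (\<Sum>i<n. kl_normal r (\<theta> i) (t i) (d i))"
    by (simp add: ln_eq sum_distrib_left)
  from ereal_integral_eq_integral[OF this] show ?thesis
    unfolding kl_loss_def using prod_normal_density_pos[of n d t] d
    by (simp add: less_imp_neq[THEN not_sym])
qed

lemma ereal_integral_cong:
  "(\<And>x. x \<in> space M \<Longrightarrow> f x = g x) \<Longrightarrow> ereal_integral M f = ereal_integral M g"
  unfolding ereal_integral_def by (intro arg_cong2[where f="(-)"] arg_cong[where f=enn2ereal] nn_integral_cong) auto

lemma ereal_integral_nonneg_ereal:
  assumes "\<And>x. x \<in> space M \<Longrightarrow> 0 \<le> f x"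
  shows "ereal_integral M f = enn2ereal (\<integral>\<^sup>+ x. e2ennreal (f x) \<partial>M)"
proof -
  have "(\<integral>\<^sup>+ x. e2ennreal (- f x) \<partial>M) = (\<integral>\<^sup>+ x. 0 \<partial>M)"
    by (rule nn_integral_cong) (use assms in \<open>auto simp: e2ennreal_neg\<close>)
  then show ?thesis by (simp add: ereal_integral_def zero_ennreal.rep_eq)
qed

lemma kl_loss_cong:
  "(\<And>y. y \<in> space (Rn n) \<Longrightarrow> p y = q y) \<Longrightarrow> kl_loss n r \<theta> p = kl_loss n r \<theta> q"
  unfolding kl_loss_def by (rule ereal_integral_cong) auto

lemma kl_risk_prod_normal:
  assumes r: "0 < r" and d: "\<And>i x. i < n \<Longrightarrow> x \<in> space (Rn n) \<Longrightarrow> 0 < d x i"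
    and p: "\<And>x y. x \<in> space (Rn n) \<Longrightarrow> y \<in> space (Rn n) \<Longrightarrow> p x y = prod_normal_density n (t x) (d x) y"
  shows "kl_risk n r \<theta> p = enn2ereal (\<integral>\<^sup>+ x. (\<Sum>i<n. ennreal (kl_normal r (\<theta> i) (t x i) (d x i)))
     * ennreal (gauss_density n \<theta> 1 x) \<partial>Rn n)"
proof -
  have loss: "kl_loss n r \<theta> (p x) = ereal (\<Sum>i<n. kl_normal r (\<theta> i) (t x i) (d x i))"
    if "x \<in> space (Rn n)" for x
    using kl_loss_cong[of n "p x" "prod_normal_density n (t x) (d x)" r \<theta>]
      kl_loss_prod_normal[OF r, of n "d x" \<theta> "t x"] p d that by auto
  have nn: "0 \<le> (\<Sum>i<n. kl_normal r (\<theta> i) (t x i) (d x i))" if "x \<in> space (Rn n)" for x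
    by (rule sum_nonneg) (use that d r in \<open>auto intro: kl_normal_nonneg\<close>)
  have "kl_risk n r \<theta> p = ereal_integral (Rn n)
      (\<lambda>x. ereal ((\<Sum>i<n. kl_normal r (\<theta> i) (t x i) (d x i)) * gauss_density n \<theta> 1 x))"
    unfolding kl_risk_def by (rule ereal_integral_cong) (simp add: loss)
  also have "\<dots> = enn2ereal (\<integral>\<^sup>+ x. ennreal ((\<Sum>i<n. kl_normal r (\<theta> i) (t x i) (d x i)) * gauss_density n \<theta> 1 x) \<partial>Rn n)"
    by (subst ereal_integral_nonneg_ereal) (auto simp: ennreal_def nn)
  also have "(\<integral>\<^sup>+ x. ennreal ((\<Sum>i<n. kl_normal r (\<theta> i) (t x i) (d x i)) * gauss_density n \<theta> 1 x) \<partial>Rn n)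
    = (\<integral>\<^sup>+ x. (\<Sum>i<n. ennreal (kl_normal r (\<theta> i) (t x i) (d x i)))
     * ennreal (gauss_density n \<theta> 1 x) \<partial>Rn n)"
    by (rule nn_integral_cong)
      (subst sum_ennreal, use d r in \<open>auto simp: ennreal_mult nn kl_normal_nonneg\<close>)
  finally show ?thesis .
qed

lemma nn_integral_normal_expectation:
  fixes f :: "real \<Rightarrow> real"
  assumes "has_bochner_integral lborel (\<lambda>u. normal_density m \<sigma> u * f u) c"
    and "\<And>u. 0 \<le> f u"
  shows "(\<integral>\<^sup>+ u. ennreal (f u) * ennreal (normal_density m \<sigma> u) \<partial>lborel) = ennreal c"
proof -
  have "(\<integral>\<^sup>+ u. ennreal (f u) * ennreal (normal_density m \<sigma> u) \<partial>lborel)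
      = (\<integral>\<^sup>+ u. ennreal (normal_density m \<sigma> u * f u) \<partial>lborel)"
    by (simp add: ennreal_mult assms mult.commute)
  also have "\<dots> = ennreal c"
    using assms by (subst nn_integral_eq_integral) (auto simp: has_bochner_integral_iff)
  finally show ?thesis .
qed

lemma borel_measurable_kl_normal [measurable (raw)]:
  assumes [measurable]: "t \<in> borel_measurable M" "d \<in> borel_measurable M"
  shows "(\<lambda>x. kl_normal r \<theta> (t x) (d x)) \<in> borel_measurable M"
  unfolding kl_normal_def by measurable

text \<open>
  If the estimate in coordinate \<open>i\<close> depends on the observation \<open>x i\<close> alone, the risk is
  a sum of one-dimensional integrals. Linear and thresholding rules are of this kind.
\<close>

lemma kl_risk_coordinatewise:
  assumes r: "0 < r" and d: "\<And>i. i < n \<Longrightarrow> 0 < d i"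
    and t [measurable]: "\<And>i. i < n \<Longrightarrow> t i \<in> borel_measurable borel"
    and p: "\<And>x y. x \<in> space (Rn n) \<Longrightarrow> y \<in> space (Rn n) \<Longrightarrow>
      p x y = prod_normal_density n (\<lambda>i. t i (x i)) d y"
  shows "kl_risk n r \<theta> p = enn2ereal (\<Sum>i<n.
    \<integral>\<^sup>+ u. ennreal (kl_normal r (\<theta> i) (t i u) (d i)) * ennreal (normal_density (\<theta> i) 1 u) \<partial>lborel)"
proof -
  have "kl_risk n r \<theta> p = enn2ereal (\<integral>\<^sup>+ x. (\<Sum>i<n. ennreal (kl_normal r (\<theta> i) (t i (x i)) (d i)))
     * ennreal (gauss_density n \<theta> 1 x) \<partial>Rn n)"
    by (rule kl_risk_prod_normal[OF r _ p]) (use d in auto)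
  also have "(\<integral>\<^sup>+ x. (\<Sum>i<n. ennreal (kl_normal r (\<theta> i) (t i (x i)) (d i)))
     * ennreal (gauss_density n \<theta> 1 x) \<partial>Rn n)
    = (\<integral>\<^sup>+ x. (\<Sum>i<n. ennreal (kl_normal r (\<theta> i) (t i (x i)) (d i))
     * ennreal (gauss_density n \<theta> 1 x)) \<partial>Rn n)"
    by (simp add: sum_distrib_right)
  also have "\<dots> = (\<Sum>i<n. \<integral>\<^sup>+ x. ennreal (kl_normal r (\<theta> i) (t i (x i)) (d i))
     * ennreal (gauss_density n \<theta> 1 x) \<partial>Rn n)"
  proof (rule nn_integral_sum)
    fix i assume "i \<in> {..<n}"
    then have i: "i < n" by simp
    have [measurable]: "(\<lambda>x. t i (x i)) \<in> borel_measurable (Rn n)"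
      using measurable_compose[OF measurable_Rn_component[OF i] t[OF i]] .
    show "(\<lambda>x. ennreal (kl_normal r (\<theta> i) (t i (x i)) (d i)) * ennreal (gauss_density n \<theta> 1 x))
      \<in> borel_measurable (Rn n)" by measurable
  qed
  also have "\<dots> = (\<Sum>i<n. \<integral>\<^sup>+ u. ennreal (kl_normal r (\<theta> i) (t i u) (d i))
     * ennreal (normal_density (\<theta> i) 1 u) \<partial>lborel)"
  proof (rule sum.cong)
    fix i assume "i \<in> {..<n}"
    then have i: "i < n" by simp
    note [measurable] = t[OF i]
    show "(\<integral>\<^sup>+ x. ennreal (kl_normal r (\<theta> i) (t i (x i)) (d i)) * ennreal (gauss_density n \<theta> 1 x) \<partial>Rn n)
      = (\<integral>\<^sup>+ u. ennreal (kl_normal r (\<theta> i) (t i u) (d i)) * ennreal (normal_density (\<theta> i) 1 u) \<partial>lborel)"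
      using nn_integral_gauss_marginal[OF i, of 1 "\<lambda>u. ennreal (kl_normal r (\<theta> i) (t i u) (d i))" \<theta>]
      by simp
  qed simp
  finally show ?thesis .
qed

section \<open>Linear estimators\<close>

text \<open>
  Bias \<open>(1 - \<alpha>) \<theta>\<close> and variance \<open>\<alpha>\<^sup>2\<close> of \<open>\<alpha> X\<close>, substituted for the squared error in \<^const>\<open>kl_normal\<close>.
\<close>

definition linear_coord_risk :: "real \<Rightarrow> real \<Rightarrow> real \<Rightarrow> real" where
  "linear_coord_risk r \<theta> \<alpha> =
     (ln ((\<alpha> + r) / r) + (r + (1 - \<alpha>)\<^sup>2 * \<theta>\<^sup>2 + \<alpha>\<^sup>2) / (\<alpha> + r) - 1) / 2"

lemma nn_integral_kl_normal_linear:
  assumes "0 < r" "0 \<le> \<alpha>"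
  shows "(\<integral>\<^sup>+ u. ennreal (kl_normal r \<theta> (\<alpha> * u) (\<alpha> + r)) * ennreal (normal_density \<theta> 1 u) \<partial>lborel)
    = ennreal (linear_coord_risk r \<theta> \<alpha>)"
proof (rule nn_integral_normal_expectation)
  define d where "d = \<alpha> + r"
  have d: "0 < d" using assms by (simp add: d_def)
  define a where "a = (ln (d / r) + (r + ((1 - \<alpha>) * \<theta>)\<^sup>2) / d - 1) / 2"
  define b where "b = - ((1 - \<alpha>) * \<theta> * \<alpha> / d)"
  define c where "c = \<alpha>\<^sup>2 / (2 * d)"
  have "kl_normal r \<theta> (\<alpha> * u) d = a + b * (u - \<theta>) + c * (u - \<theta>)\<^sup>2" for u
  proof -
    have "(\<theta> - \<alpha> * u)\<^sup>2 = ((1 - \<alpha>) * \<theta>)\<^sup>2 - 2 * ((1 - \<alpha>) * \<theta> * \<alpha>) * (u - \<theta>) + \<alpha>\<^sup>2 * (u - \<theta>)\<^sup>2"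
      by algebra
    then show ?thesis
      unfolding kl_normal_def a_def b_def c_def
      by (simp add: add_divide_distrib diff_divide_distrib)
  qed
  moreover have "linear_coord_risk r \<theta> \<alpha> = a + c * 1\<^sup>2"
    by (simp add: linear_coord_risk_def d_def[symmetric] a_def c_def add_divide_distrib diff_divide_distrib power_mult_distrib)
  ultimately show "has_bochner_integral lborel
      (\<lambda>u. normal_density \<theta> 1 u * kl_normal r \<theta> (\<alpha> * u) (\<alpha> + r)) (linear_coord_risk r \<theta> \<alpha>)"
    using normal_quadratic_expectation[of 1 \<theta> a b c] by (simp add: d_def)
qed (use assms in \<open>auto intro: kl_normal_nonneg\<close>)

lemma linear_coord_risk_nonneg:
  assumes "0 < r" "0 \<le> \<alpha>" shows "0 \<le> linear_coord_risk r \<theta> \<alpha>"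
proof -
  have "0 \<le> kl_normal r ((1 - \<alpha>) * \<theta>) 0 (\<alpha> + r)"
    using assms by (intro kl_normal_nonneg) auto
  also have "\<dots> \<le> linear_coord_risk r \<theta> \<alpha>"
    using assms unfolding kl_normal_def linear_coord_risk_def
    by (intro divide_right_mono diff_right_mono add_left_mono) (auto simp: power_mult_distrib)
  finally show ?thesis .
qed

lemma zero_in_sparse_space: "(\<lambda>i\<in>{..<n}. 0) \<in> sparse_space n s"
proof -
  have "{i \<in> {..<n}. (\<lambda>i\<in>{..<n}. 0::real) i \<noteq> 0} = {}" by auto
  then show ?thesis by (simp add: sparse_space_def Rn_def space_PiM)
qed

lemma single_spike_in_sparse_space:
  assumes "0 < s" shows "(\<lambda>i\<in>{..<n}. if i = j then M else 0) \<in> sparse_space n s"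
proof -
  have "{i \<in> {..<n}. (\<lambda>i\<in>{..<n}. if i = j then M else (0::real)) i \<noteq> 0} \<subseteq> {j}" by auto
  from card_mono[OF _ this]
  have "card {i \<in> {..<n}. (\<lambda>i\<in>{..<n}. if i = j then M else (0::real)) i \<noteq> 0} \<le> 1" by simp
  then show ?thesis using assms by (simp add: sparse_space_def Rn_def space_PiM)
qed

lemma kl_risk_linear:
  assumes r: "0 < r" and \<alpha>: "\<And>i. i < n \<Longrightarrow> 0 \<le> \<alpha> i"
    and p: "\<And>x y. x \<in> space (Rn n) \<Longrightarrow> y \<in> space (Rn n) \<Longrightarrow>
      p x y = prod_normal_density n (\<lambda>i. \<alpha> i * x i) (\<lambda>i. \<alpha> i + r) y"
  shows "kl_risk n r \<theta> p = ereal (\<Sum>i<n. linear_coord_risk r (\<theta> i) (\<alpha> i))"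
proof -
  have "kl_risk n r \<theta> p = enn2ereal (\<Sum>i<n. ennreal (linear_coord_risk r (\<theta> i) (\<alpha> i)))"
    by (subst kl_risk_coordinatewise[OF r _ _ p])
      (use r \<alpha> in \<open>auto simp: nn_integral_kl_normal_linear add_nonneg_pos intro!: sum.cong\<close>)
  also have "\<dots> = ereal (\<Sum>i<n. linear_coord_risk r (\<theta> i) (\<alpha> i))"
    using r \<alpha> by (subst sum_ennreal) (auto simp: linear_coord_risk_nonneg intro!: sum_nonneg enn2ereal_ennreal)
  finally show ?thesis .
qed

text \<open>
  The rule \<open>\<alpha> = 1\<close> is unbiased and its risk does not depend on \<open>\<theta>\<close>. Any other
  linear rule shrinks some coordinate, and a single spike there makes its bias as large as desired.
\<close>

lemma R_L_sparse_space:
  assumes r: "0 < r" and s: "0 < s"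
  shows "R_L r n (sparse_space n s) = ereal (real n / 2 * ln (1 + inverse r))"
  unfolding minimax_risk_def
proof (rule antisym)
  let ?c = "real n / 2 * ln (1 + inverse r)"
  let ?p = "\<lambda>x y. prod_normal_density n (\<lambda>i. 1 * x i) (\<lambda>i. 1 + r) y"
  have one: "linear_coord_risk r t 1 = ln (1 + inverse r) / 2" for t
    using r by (simp add: linear_coord_risk_def field_simps)
  have "kl_risk n r \<theta> ?p = ereal ?c" for \<theta>
    by (subst kl_risk_linear[OF r, of n "\<lambda>_. 1"]) (auto simp: one)
  then have "(SUP \<theta>\<in>sparse_space n s. kl_risk n r \<theta> ?p) \<le> ereal ?c" by (auto intro: SUP_least)
  moreover have "?p \<in> linear_estimators n r"
    unfolding linear_estimators_def by (intro CollectI exI[of _ "\<lambda>_. 1"]) auto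
  ultimately show "(INF p\<in>linear_estimators n r. SUP \<theta>\<in>sparse_space n s. kl_risk n r \<theta> p) \<le> ereal ?c"
    by (rule INF_lower2[rotated])
  show "ereal ?c \<le> (INF p\<in>linear_estimators n r. SUP \<theta>\<in>sparse_space n s. kl_risk n r \<theta> p)"
  proof (rule INF_greatest)
    fix p assume "p \<in> linear_estimators n r"
    then obtain \<alpha> where \<alpha>: "\<And>i. i < n \<Longrightarrow> 0 \<le> \<alpha> i" "\<And>i. i < n \<Longrightarrow> \<alpha> i \<le> 1"
      and p: "\<And>x y. x \<in> space (Rn n) \<Longrightarrow> y \<in> space (Rn n) \<Longrightarrow>
        p x y = prod_normal_density n (\<lambda>i. \<alpha> i * x i) (\<lambda>i. \<alpha> i + r) y"
      unfolding linear_estimators_def by auto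
    have risk: "kl_risk n r \<theta> p = ereal (\<Sum>i<n. linear_coord_risk r (\<theta> i) (\<alpha> i))" for \<theta>
      using kl_risk_linear[OF r \<alpha>(1) p] by simp
    show "ereal ?c \<le> (SUP \<theta>\<in>sparse_space n s. kl_risk n r \<theta> p)"
    proof (cases "\<forall>i<n. \<alpha> i = 1")
      case True
      have "kl_risk n r (\<lambda>i\<in>{..<n}. 0) p = ereal ?c"
        unfolding risk using True by (simp add: one)
      then show ?thesis using SUP_upper[OF zero_in_sparse_space, of "\<lambda>\<theta>. kl_risk n r \<theta> p" n s] by simp
    next
      case False
      then obtain j where j: "j < n" "\<alpha> j \<noteq> 1" by auto
      with \<alpha>[OF j(1)] have \<alpha>j: "0 \<le> \<alpha> j" "\<alpha> j < 1" by auto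
      \<comment> \<open>a spike in coordinate \<open>j\<close>, high enough for its squared bias to exceed the target\<close>
      define M where "M = sqrt ((2 * ?c + 1) * (\<alpha> j + r)) / (1 - \<alpha> j)"
      let ?\<theta> = "\<lambda>i\<in>{..<n}. if i = j then M else 0"
      have c0: "0 \<le> ?c" using r by simp
      have "(1 - \<alpha> j)\<^sup>2 * M\<^sup>2 = (2 * ?c + 1) * (\<alpha> j + r)"
        using \<alpha>j r c0 by (simp add: M_def power_divide)
      then have "linear_coord_risk r M (\<alpha> j) =
        (ln ((\<alpha> j + r) / r) + (r + (2 * ?c + 1) * (\<alpha> j + r) + (\<alpha> j)\<^sup>2) / (\<alpha> j + r) - 1) / 2"
        by (simp add: linear_coord_risk_def)
      also have "\<dots> = (ln ((\<alpha> j + r) / r) + (r + (\<alpha> j)\<^sup>2) / (\<alpha> j + r)) / 2 + ?c"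
        using \<alpha>j r by (simp add: add_divide_distrib diff_divide_distrib)
      finally have "?c \<le> linear_coord_risk r M (\<alpha> j)" using \<alpha>j r by simp
      also have "\<dots> = linear_coord_risk r (?\<theta> j) (\<alpha> j)" using j by simp
      also have "\<dots> \<le> (\<Sum>i<n. linear_coord_risk r (?\<theta> i) (\<alpha> i))"
        using j r \<alpha> by (intro member_le_sum) (auto intro!: linear_coord_risk_nonneg)
      finally have "ereal ?c \<le> kl_risk n r ?\<theta> p" unfolding risk by simp
      also have "\<dots> \<le> (SUP \<theta>\<in>sparse_space n s. kl_risk n r \<theta> p)"
        by (rule SUP_upper[OF single_spike_in_sparse_space[OF s]])
      finally show ?thesis .
    qed
  qed
qed

section \<open>The upper bound by soft thresholding\<close>

definition soft :: "real \<Rightarrow> real \<Rightarrow> real" where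
  "soft l x = (if l < x then x - l else if x < - l then x + l else 0)"

lemma measurable_soft [measurable]: "soft l \<in> borel_measurable borel"
  unfolding soft_def by measurable

text \<open>
  Beyond the threshold the standard normal density is at most \<open>exp (- l\<^sup>2 / 2)\<close> times the density
  centred at the threshold, because \<open>x\<^sup>2 \<ge> l\<^sup>2 + (x - l)\<^sup>2\<close> for \<open>x \<ge> l \<ge> 0\<close>. Bounding by the full
  second moments of the two shifted normal laws avoids any tail integral.
\<close>

lemma soft_square_times_std_normal_le:
  assumes "0 \<le> l"
  shows "(soft l x)\<^sup>2 * normal_density 0 1 x \<le>
    exp (- l\<^sup>2 / 2) * (normal_density l 1 x * (x - l)\<^sup>2 + normal_density (- l) 1 x * (x - (- l))\<^sup>2)"
proof -
  have shift: "normal_density 0 1 x \<le> exp (- l\<^sup>2 / 2) * normal_density m 1 x"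
    if "m\<^sup>2 = l\<^sup>2" "m\<^sup>2 \<le> m * x" for m
  proof -
    have "- (x - 0)\<^sup>2 / 2 \<le> - l\<^sup>2 / 2 + - (x - m)\<^sup>2 / 2"
      using that by (simp add: power2_eq_square field_simps)
    then have "exp (- (x - 0)\<^sup>2 / 2) \<le> exp (- l\<^sup>2 / 2) * exp (- (x - m)\<^sup>2 / 2)"
      by (simp only: exp_add[symmetric] exp_le_cancel_iff)
    then show ?thesis by (simp add: normal_density_def divide_right_mono)
  qed
  consider "l < x" | "x < - l" | "- l \<le> x" "x \<le> l" by linarith
  then show ?thesis
  proof cases
    case 1
    have "normal_density 0 1 x \<le> exp (- l\<^sup>2 / 2) * normal_density l 1 x"
      by (rule shift) (use 1 assms in \<open>auto simp: power2_eq_square intro: mult_left_mono\<close>)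
    from mult_left_mono[OF this, of "(x - l)\<^sup>2"]
    have "(soft l x)\<^sup>2 * normal_density 0 1 x \<le> exp (- l\<^sup>2 / 2) * (normal_density l 1 x * (x - l)\<^sup>2)"
      using 1 by (simp add: soft_def mult_ac)
    also have "\<dots> \<le> exp (- l\<^sup>2 / 2) * (normal_density l 1 x * (x - l)\<^sup>2 + normal_density (- l) 1 x * (x - (- l))\<^sup>2)"
      by (intro mult_left_mono) auto
    finally show ?thesis .
  next
    case 2
    have "l * l \<le> l * (- x)" using 2 assms by (intro mult_left_mono) auto
    then have "normal_density 0 1 x \<le> exp (- l\<^sup>2 / 2) * normal_density (- l) 1 x"
      by (intro shift) (auto simp: power2_eq_square)
    from mult_left_mono[OF this, of "(x + l)\<^sup>2"]
    have "(soft l x)\<^sup>2 * normal_density 0 1 x \<le> exp (- l\<^sup>2 / 2) * (normal_density (- l) 1 x * (x - (- l))\<^sup>2)"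
      using 2 assms by (simp add: soft_def mult_ac)
    also have "\<dots> \<le> exp (- l\<^sup>2 / 2) * (normal_density l 1 x * (x - l)\<^sup>2 + normal_density (- l) 1 x * (x - (- l))\<^sup>2)"
      by (intro mult_left_mono) auto
    finally show ?thesis .
  next
    case 3
    then show ?thesis by (simp add: soft_def)
  qed
qed

lemma soft_risk_at_zero:
  assumes l: "0 \<le> l"
  shows "(\<integral>\<^sup>+ u. ennreal ((0 - soft l u)\<^sup>2) * ennreal (normal_density 0 1 u) \<partial>lborel)
    \<le> ennreal (2 * exp (- l\<^sup>2 / 2))"
proof -
  let ?g = "\<lambda>u. exp (- l\<^sup>2 / 2) * (normal_density l 1 u * (u - l)\<^sup>2 + normal_density (- l) 1 u * (u - (- l))\<^sup>2)"
  have b: "has_bochner_integral lborel (\<lambda>u. normal_density m 1 u * (u - m)\<^sup>2) 1" for m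
    using normal_moment_even[of 1 m 1] by simp
  have hb: "has_bochner_integral lborel ?g (2 * exp (- l\<^sup>2 / 2))"
    using has_bochner_integral_mult_right[OF has_bochner_integral_add[OF b b], of "exp (- l\<^sup>2 / 2)" l "- l"]
    by (simp add: mult.commute)
  have "(\<integral>\<^sup>+ u. ennreal ((0 - soft l u)\<^sup>2) * ennreal (normal_density 0 1 u) \<partial>lborel)
    \<le> (\<integral>\<^sup>+ u. ennreal (?g u) \<partial>lborel)"
    using soft_square_times_std_normal_le[OF l]
    by (intro nn_integral_mono) (simp add: ennreal_mult[symmetric])
  also have "\<dots> = ennreal (2 * exp (- l\<^sup>2 / 2))"
    using hb by (subst nn_integral_eq_integral) (auto simp: has_bochner_integral_iff)
  finally show ?thesis .
qed

text \<open>
  The soft threshold moves the observation by at most \<open>l\<close>, so the error is at most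
  \<open>\<bar>u - \<theta>\<bar> + l\<close>, whose second moment is at most \<open>(1 + l)\<^sup>2\<close>.
\<close>

lemma soft_risk_le:
  assumes l: "0 \<le> l"
  shows "(\<integral>\<^sup>+ u. ennreal ((\<theta> - soft l u)\<^sup>2) * ennreal (normal_density \<theta> 1 u) \<partial>lborel)
    \<le> ennreal ((1 + l)\<^sup>2)"
proof -
  have le: "(\<theta> - soft l u)\<^sup>2 \<le> (l + l\<^sup>2) + 0 * (u - \<theta>) + (1 + l) * (u - \<theta>)\<^sup>2" for u
  proof -
    let ?a = "\<bar>u - \<theta>\<bar>"
    have "\<bar>u - soft l u\<bar> \<le> l" using l by (simp add: soft_def abs_le_iff)
    then have "\<bar>\<theta> - soft l u\<bar> \<le> ?a + l" by linarith
    then have "(\<theta> - soft l u)\<^sup>2 \<le> (?a + l)\<^sup>2" using power_mono[OF _ abs_ge_zero] by (simp only: power2_abs[symmetric, of "\<theta> - soft l u"])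
    also have "\<dots> = ?a\<^sup>2 + l * (2 * ?a) + l\<^sup>2" by (simp only: power2_sum) simp
    also have "\<dots> \<le> ?a\<^sup>2 + l * (?a\<^sup>2 + 1) + l\<^sup>2"
    proof -
      have "2 * ?a \<le> ?a\<^sup>2 + 1" using sum_squares_bound[of ?a 1] by simp
      then show ?thesis using l by (intro add_mono mult_left_mono) auto
    qed
    finally show ?thesis by (simp add: algebra_simps)
  qed
  have "(\<integral>\<^sup>+ u. ennreal ((\<theta> - soft l u)\<^sup>2) * ennreal (normal_density \<theta> 1 u) \<partial>lborel)
    \<le> (\<integral>\<^sup>+ u. ennreal ((l + l\<^sup>2) + 0 * (u - \<theta>) + (1 + l) * (u - \<theta>)\<^sup>2) * ennreal (normal_density \<theta> 1 u) \<partial>lborel)"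
    using le by (intro nn_integral_mono mult_right_mono ennreal_leI) auto
  also have "\<dots> = ennreal ((l + l\<^sup>2) + (1 + l) * 1\<^sup>2)"
    by (rule nn_integral_normal_expectation[OF normal_quadratic_expectation]) (use l in simp_all)
  also have "(l + l\<^sup>2) + (1 + l) * 1\<^sup>2 = (1 + l)\<^sup>2" by (simp add: power2_eq_square algebra_simps)
  finally show ?thesis .
qed

text \<open>
  The threshold \<open>l = sqrt (2 ln (n/s))\<close> satisfies \<open>exp (- l\<^sup>2 / 2) = s / n\<close>. The \<open>n\<close> coordinates
  contribute at most \<open>2 s / n\<close> each, in total \<open>2 s\<close>, and the at most \<open>s\<close> nonzero ones another
  \<open>(1 + l)\<^sup>2\<close> each.
\<close>

definition sparse_bound :: "real \<Rightarrow> nat \<Rightarrow> nat \<Rightarrow> real" where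
  "sparse_bound r n s = real s / (2 * r) * (2 + (1 + sqrt (2 * ln (real n / real s)))\<^sup>2)"

lemma soft_threshold_estimator:
  assumes r: "0 < r" and s: "0 < s" "s \<le> n"
  obtains p where "p \<in> plugin_estimators n r" "p \<in> all_estimators n"
    "\<And>\<theta>. \<theta> \<in> sparse_space n s \<Longrightarrow> kl_risk n r \<theta> p \<le> ereal (sparse_bound r n s)"
proof
  define l where "l = sqrt (2 * ln (real n / real s))"
  have n: "0 < n" using s by simp
  have L: "0 \<le> ln (real n / real s)" using s by simp
  have l0: "0 \<le> l" using L by (simp add: l_def)
  have exp_l: "exp (- l\<^sup>2 / 2) = real s / real n"
    using L s n by (simp add: l_def exp_minus)
  define t where "t x = (\<lambda>i\<in>{..<n}. soft l (x i))" for x :: "nat \<Rightarrow> real"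
  define p where "p x y = gauss_density n (t x) r y" for x y
  have tm: "t \<in> Rn n \<rightarrow>\<^sub>M Rn n"
    unfolding t_def by (subst (2) Rn_def, rule measurable_restrict) simp
  show "p \<in> plugin_estimators n r"
    unfolding plugin_estimators_def p_def using tm by blast
  have "(\<lambda>(x, y). p x y) = (\<lambda>z. \<Prod>i<n. normal_density (soft l (fst z i)) (sqrt r) (snd z i))"
    by (auto simp: p_def gauss_density_def prod_normal_density_def t_def)
  moreover have "\<dots> \<in> borel_measurable (Rn n \<Otimes>\<^sub>M Rn n)"
  proof (rule borel_measurable_prod)
    fix i assume "i \<in> {..<n}"
    then have i: "i < n" by simp
    have [measurable]: "(\<lambda>z. fst z i) \<in> borel_measurable (Rn n \<Otimes>\<^sub>M Rn n)"
      "(\<lambda>z. snd z i) \<in> borel_measurable (Rn n \<Otimes>\<^sub>M Rn n)"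
      using measurable_compose[OF measurable_fst measurable_Rn_component[OF i]]
        measurable_compose[OF measurable_snd measurable_Rn_component[OF i]] by auto
    show "(\<lambda>z. normal_density (soft l (fst z i)) (sqrt r) (snd z i)) \<in> borel_measurable (Rn n \<Otimes>\<^sub>M Rn n)"
      unfolding normal_density_def by measurable
  qed
  ultimately show "p \<in> all_estimators n"
    unfolding all_estimators_def by (simp, simp add: p_def nn_integral_gauss_density[OF r])
  fix \<theta> assume \<theta>: "\<theta> \<in> sparse_space n s"
  define b where "b i = (2 * (real s / real n) + (if \<theta> i \<noteq> 0 then (1 + l)\<^sup>2 else 0)) / (2 * r)" for i
  have b0: "0 \<le> b i" for i using r by (simp add: b_def)
  have "kl_risk n r \<theta> p = enn2ereal (\<Sum>i<n.
    \<integral>\<^sup>+ u. ennreal (kl_normal r (\<theta> i) (soft l u) r) * ennreal (normal_density (\<theta> i) 1 u) \<partial>lborel)"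
    by (rule kl_risk_coordinatewise[OF r])
      (use r in \<open>auto simp: p_def t_def gauss_density_def prod_normal_density_def\<close>)
  also have "\<dots> \<le> enn2ereal (\<Sum>i<n. ennreal (b i))"
    unfolding less_eq_ennreal.rep_eq[symmetric]
  proof (rule sum_mono)
    fix i
    let ?I = "\<integral>\<^sup>+ u. ennreal ((\<theta> i - soft l u)\<^sup>2) * ennreal (normal_density (\<theta> i) 1 u) \<partial>lborel"
    have "ennreal (kl_normal r (\<theta> i) (soft l u) r) * ennreal (normal_density (\<theta> i) 1 u)
      = ennreal (1 / (2 * r)) * (ennreal ((\<theta> i - soft l u)\<^sup>2) * ennreal (normal_density (\<theta> i) 1 u))" for u
      using r by (simp add: kl_normal_def ennreal_mult[symmetric] add_divide_distrib)
    then have "(\<integral>\<^sup>+ u. ennreal (kl_normal r (\<theta> i) (soft l u) r) * ennreal (normal_density (\<theta> i) 1 u) \<partial>lborel)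
      = ennreal (1 / (2 * r)) * ?I"
      by (simp add: nn_integral_cmult)
    also have "\<dots> \<le> ennreal (1 / (2 * r)) * ennreal (2 * r * b i)"
    proof (rule mult_left_mono)
      show "?I \<le> ennreal (2 * r * b i)"
      proof (cases "\<theta> i = 0")
        case True
        then show ?thesis using soft_risk_at_zero[OF l0, unfolded exp_l] r by (simp add: b_def)
      next
        case False
        have "?I \<le> ennreal ((1 + l)\<^sup>2)" by (rule soft_risk_le[OF l0])
        also have "\<dots> \<le> ennreal (2 * r * b i)" using False r by (intro ennreal_leI) (simp add: b_def)
        finally show ?thesis .
      qed
    qed simp
    also have "\<dots> = ennreal (b i)" using r b0 by (simp add: ennreal_mult[symmetric])
    finally show "(\<integral>\<^sup>+ u. ennreal (kl_normal r (\<theta> i) (soft l u) r) * ennreal (normal_density (\<theta> i) 1 u) \<partial>lborel)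
      \<le> ennreal (b i)" .
  qed
  also have "\<dots> = ereal (\<Sum>i<n. b i)"
    using b0 by (subst sum_ennreal) (auto simp: enn2ereal_ennreal sum_nonneg)
  also have "(\<Sum>i<n. b i) \<le> sparse_bound r n s"
  proof -
    have "(\<Sum>i<n. if \<theta> i \<noteq> 0 then (1 + l)\<^sup>2 else 0) = real (card {i \<in> {..<n}. \<theta> i \<noteq> 0}) * (1 + l)\<^sup>2"
      by (subst sum.inter_filter[symmetric]) auto
    also have "\<dots> \<le> real s * (1 + l)\<^sup>2"
      using \<theta> by (intro mult_right_mono) (auto simp: sparse_space_def)
    finally have "(\<Sum>i<n. 2 * (real s / real n) + (if \<theta> i \<noteq> 0 then (1 + l)\<^sup>2 else 0)) \<le> real s * (2 + (1 + l)\<^sup>2)"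
      using n by (simp add: sum.distrib algebra_simps)
    from divide_right_mono[OF this, of "2 * r"] show ?thesis
      unfolding b_def sum_divide_distrib[symmetric] sparse_bound_def l_def[symmetric] using r by simp
  qed
  finally show "kl_risk n r \<theta> p \<le> ereal (sparse_bound r n s)" by simp
qed

lemma minimax_le_sparse_bound:
  assumes "0 < r" "0 < s" "s \<le> n"
  shows "R_E r n (sparse_space n s) \<le> ereal (sparse_bound r n s)"
    and "R_N r n (sparse_space n s) \<le> ereal (sparse_bound r n s)"
proof -
  obtain p where p: "p \<in> plugin_estimators n r" "p \<in> all_estimators n"
    "\<And>\<theta>. \<theta> \<in> sparse_space n s \<Longrightarrow> kl_risk n r \<theta> p \<le> ereal (sparse_bound r n s)"
    using soft_threshold_estimator[OF assms] by metis
  then have *: "(SUP \<theta>\<in>sparse_space n s. kl_risk n r \<theta> p) \<le> ereal (sparse_bound r n s)"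
    by (intro SUP_least)
  show "R_E r n (sparse_space n s) \<le> ereal (sparse_bound r n s)"
    unfolding minimax_risk_def by (rule INF_lower2[OF p(1)]) (rule *)
  show "R_N r n (sparse_space n s) \<le> ereal (sparse_bound r n s)"
    unfolding minimax_risk_def by (rule INF_lower2[OF p(2)]) (rule *)
qed

lemma R_G_le_R_E:
  assumes "0 < r" shows "R_G r n \<Theta> \<le> R_E r n \<Theta>"
  unfolding minimax_risk_def
proof (rule INF_superset_mono)
  show "plugin_estimators n r \<subseteq> gaussian_estimators n"
  proof
    fix p assume "p \<in> plugin_estimators n r"
    then obtain t where t: "t \<in> Rn n \<rightarrow>\<^sub>M Rn n"
      "\<And>x y. x \<in> space (Rn n) \<Longrightarrow> y \<in> space (Rn n) \<Longrightarrow> p x y = gauss_density n (t x) r y"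
      unfolding plugin_estimators_def by auto
    have "\<forall>i<n. (\<lambda>x. t x i) \<in> borel_measurable (Rn n)"
      using measurable_compose[OF t(1) measurable_Rn_component] by blast
    then show "p \<in> gaussian_estimators n"
      unfolding gaussian_estimators_def using t(2) assms
      by (intro CollectI exI[of _ "\<lambda>i x. t x i"] exI[of _ "\<lambda>_ _. r"]) (auto simp: gauss_density_def)
  qed
qed auto

section \<open>The lower bound by a block prior\<close>

text \<open>
  The right-hand side is a posterior risk to be minimised over \<open>t\<close> and \<open>d\<close>. With \<open>S = A + B\<close> and
  \<open>V = \<mu>\<^sup>2 A B / S\<^sup>2\<close>, the variance of the two-point law with weights \<open>A\<close> at \<open>\<mu>\<close> and \<open>B\<close> at \<open>0\<close>,
  the minimum is \<open>S ln (1 + V/r) / 2 \<ge> S V / (2 (r + V))\<close>. If the odds \<open>A / B\<close> of the spike are at most a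
  small \<open>\<tau>\<close>, then \<open>S V\<close> is close to \<open>A \<mu>\<^sup>2\<close> and \<open>V\<close> is negligible against \<open>r\<close>, so
  adapting the variance \<open>d\<close> gains almost nothing over the plug-in value \<open>A \<mu>\<^sup>2 / (2 r)\<close>.
\<close>

lemma kl_normal_two_point:
  assumes r: "0 < r" and d: "0 < d" and A: "0 \<le> A" and B: "0 < B" and AB: "A \<le> \<tau> * B"
  shows "A * (\<mu>\<^sup>2 / (2 * (1 + \<tau>) * (r + \<mu>\<^sup>2 * \<tau>)))
    \<le> A * kl_normal r \<mu> t d + B * kl_normal r 0 t d"
proof -
  define S where "S = A + B"
  define V where "V = \<mu>\<^sup>2 * (A / S) * (B / S)"
  have S: "0 < S" using A B by (simp add: S_def)
  have \<tau>: "0 \<le> \<tau>" using order_trans[OF A AB] B by (simp add: zero_le_mult_iff)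
  have V: "0 \<le> V" using A B S by (simp add: V_def)
  have SV: "S * V = \<mu>\<^sup>2 * A * (B / S)" using S by (simp add: V_def)
  have AS: "A / S \<le> \<tau>"
  proof -
    have "A \<le> \<tau> * S" using AB A \<tau> by (simp add: S_def distrib_left add_increasing)
    then show ?thesis using S by (simp add: pos_divide_le_eq)
  qed
  have BS: "1 / (1 + \<tau>) \<le> B / S"
    using AB \<tau> S by (simp add: S_def field_simps)
  have V_le: "V \<le> \<mu>\<^sup>2 * \<tau>"
  proof -
    have "B / S \<le> 1" using A B by (simp add: S_def)
    then have "(A / S) * (B / S) \<le> \<tau> * 1"
      using AS A B S \<tau> by (intro mult_mono) auto
    from mult_left_mono[OF this, of "\<mu>\<^sup>2"] show ?thesis by (simp add: V_def)
  qed
  \<comment> \<open>The weighted squared error is least at the mean \<open>t = A \<mu> / S\<close>, with value \<open>S V\<close>.\<close>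
  have quad: "S * V \<le> A * (\<mu> - t)\<^sup>2 + B * (0 - t)\<^sup>2"
  proof -
    have "S * (A * (\<mu> - t)\<^sup>2 + B * (0 - t)\<^sup>2) - \<mu>\<^sup>2 * A * B = (S * t - A * \<mu>)\<^sup>2"
      unfolding S_def by (simp add: power2_eq_square algebra_simps)
    moreover have "0 \<le> (S * t - A * \<mu>)\<^sup>2" by simp
    ultimately have "\<mu>\<^sup>2 * A * B \<le> S * (A * (\<mu> - t)\<^sup>2 + B * (0 - t)\<^sup>2)" by linarith
    then show ?thesis unfolding SV using S by (simp add: pos_divide_le_eq mult.commute)
  qed
  \<comment> \<open>The best variance is \<open>d = r + V\<close>, with value \<open>ln ((r + V) / r)\<close>.\<close>
  have gain: "V / (r + V) \<le> ln (d / r) + (r + V) / d - 1"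
  proof -
    have "1 \<le> ln (d / (r + V)) + (r + V) / d"
      using ln_add_inverse_ge_1[of "d / (r + V)"] d r V by simp
    moreover have "1 \<le> ln ((r + V) / r) + r / (r + V)"
      using ln_add_inverse_ge_1[of "(r + V) / r"] r V by simp
    moreover have "r / (r + V) = 1 - V / (r + V)" using r V by (simp add: field_simps)
    moreover have "ln (d / (r + V)) = ln d - ln (r + V)" "ln ((r + V) / r) = ln (r + V) - ln r"
      "ln (d / r) = ln d - ln r"
      using d r V by (simp_all add: ln_div)
    ultimately show ?thesis by linarith
  qed
  have "A * (\<mu>\<^sup>2 / (2 * (1 + \<tau>) * (r + \<mu>\<^sup>2 * \<tau>)))
      = (\<mu>\<^sup>2 * A * (1 / (1 + \<tau>))) * (1 / (r + \<mu>\<^sup>2 * \<tau>)) / 2"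
    by (simp only: times_divide_eq_right times_divide_eq_left divide_divide_eq_left mult_1_right mult_ac)
  also have "\<dots> \<le> (\<mu>\<^sup>2 * A * (B / S)) * (1 / (r + V)) / 2"
    using BS V_le V r A B S \<tau>
    by (intro divide_right_mono mult_mono divide_left_mono) auto
  also have "\<dots> = S * (V / (r + V)) / 2" unfolding SV[symmetric] by simp
  also have "\<dots> \<le> S * (ln (d / r) + (r + V) / d - 1) / 2"
    using gain S by (intro divide_right_mono mult_left_mono) auto
  also have "\<dots> = S * (ln (d / r) + r / d - 1) / 2 + S * V / d / 2"
    by (simp add: add_divide_distrib diff_divide_distrib algebra_simps)
  also have "\<dots> \<le> S * (ln (d / r) + r / d - 1) / 2 + (A * (\<mu> - t)\<^sup>2 + B * (0 - t)\<^sup>2) / d / 2"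
    using quad d by (intro add_left_mono divide_right_mono) auto
  also have "\<dots> = A * kl_normal r \<mu> t d + B * kl_normal r 0 t d"
    unfolding S_def kl_normal_def by (simp add: add_divide_distrib diff_divide_distrib algebra_simps)
  finally show ?thesis .
qed

lemma gauss_density_shift_coordinate:
  assumes i: "i < n" and "\<theta> i = 0"
  shows "gauss_density n (\<theta>(i := \<mu>)) 1 x = gauss_density n \<theta> 1 x * exp (\<mu> * x i - \<mu>\<^sup>2 / 2)"
proof -
  have "normal_density \<mu> 1 (x i) = normal_density 0 1 (x i) * exp (\<mu> * x i - \<mu>\<^sup>2 / 2)"
    by (simp add: normal_density_def exp_add[symmetric] power2_eq_square field_simps)
  moreover have "(\<Prod>j\<in>{..<n}-{i}. normal_density ((\<theta>(i := \<mu>)) j) (sqrt 1) (x j))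
    = (\<Prod>j\<in>{..<n}-{i}. normal_density (\<theta> j) (sqrt 1) (x j))"
    by (rule prod.cong) auto
  ultimately show ?thesis
    using assms(2) by (simp add: gauss_density_split[OF i])
qed

lemma ennreal_le_nn_integral:
  fixes f :: "'a \<Rightarrow> real"
  assumes "has_bochner_integral M f c"
  shows "ennreal c \<le> (\<integral>\<^sup>+ x. ennreal (f x) \<partial>M)"
proof -
  have "integrable M f" and c: "integral\<^sup>L M f = c"
    using assms by (auto simp: has_bochner_integral_iff)
  then obtain a b where "0 \<le> b" "(\<integral>\<^sup>+ x. ennreal (f x) \<partial>M) = ennreal a" "c = a - b"
    using integrableE by metis
  then show ?thesis by (simp add: ennreal_leI)
qed

definition coord_risk ::
  "nat \<Rightarrow> real \<Rightarrow> (nat \<Rightarrow> (nat \<Rightarrow> real) \<Rightarrow> real) \<Rightarrow> (nat \<Rightarrow> (nat \<Rightarrow> real) \<Rightarrow> real) \<Rightarrow>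
   nat \<Rightarrow> (nat \<Rightarrow> real) \<Rightarrow> ennreal" where
  "coord_risk n r t d i \<theta> =
     (\<integral>\<^sup>+ x. ennreal (kl_normal r (\<theta> i) (t i x) (d i x)) * ennreal (gauss_density n \<theta> 1 x) \<partial>Rn n)"

text \<open>
  The bound of \<open>kl_normal_two_point\<close> per unit weight of a spike, times the Chebyshev
  lower bound for the probability that the noise at the spike is at most \<open>K\<close>.
\<close>

definition spike_gain :: "real \<Rightarrow> real \<Rightarrow> real \<Rightarrow> real \<Rightarrow> real" where
  "spike_gain r \<mu> \<tau> K = \<mu>\<^sup>2 / (2 * (1 + \<tau>) * (r + \<mu>\<^sup>2 * \<tau>)) * (1 - 1 / K\<^sup>2)"

text \<open>
  The likelihood ratio of spike against no spike is \<open>exp (\<mu> x\<^sub>i - \<mu>\<^sup>2 / 2)\<close>. It is at most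
  \<open>exp (\<mu>\<^sup>2 / 2 + K \<mu>)\<close> on the event \<open>x\<^sub>i \<le> \<mu> + K\<close>, where the pointwise bound for small odds
  applies. The indicator of this event is replaced by the smaller function
  \<open>1 - (x\<^sub>i - \<mu>)\<^sup>2 / K\<^sup>2\<close>, whose mean under the spike is \<open>1 - 1 / K\<^sup>2\<close>.
\<close>

lemma coord_risk_spike_or_zero:
  assumes r: "0 < r" and i: "i < n" and \<theta>: "\<theta> i = 0"
    and [measurable]: "t i \<in> borel_measurable (Rn n)" "d i \<in> borel_measurable (Rn n)"
    and d: "\<And>x. x \<in> space (Rn n) \<Longrightarrow> 0 < d i x"
    and w: "0 < w0" "0 < w1" and K: "0 < K" and \<mu>: "0 \<le> \<mu>"
    and \<tau>: "w1 * exp (\<mu>\<^sup>2 / 2 + K * \<mu>) \<le> \<tau> * w0"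
  shows "ennreal (w1 * spike_gain r \<mu> \<tau> K)
    \<le> ennreal w0 * coord_risk n r t d i \<theta> + ennreal w1 * coord_risk n r t d i (\<theta>(i := \<mu>))"
proof -
  define \<kappa> where "\<kappa> = \<mu>\<^sup>2 / (2 * (1 + \<tau>) * (r + \<mu>\<^sup>2 * \<tau>))"
  have "0 \<le> w1 * exp (\<mu>\<^sup>2 / 2 + K * \<mu>)" using w by simp
  from order_trans[OF this \<tau>] have \<tau>0: "0 \<le> \<tau>" using w by (simp add: zero_le_mult_iff)
  have \<kappa>: "0 \<le> \<kappa>" using r \<tau>0 by (simp add: \<kappa>_def)
  let ?\<phi>0 = "gauss_density n \<theta> 1" and ?\<phi>1 = "gauss_density n (\<theta>(i := \<mu>)) 1"
  let ?k0 = "\<lambda>x. kl_normal r 0 (t i x) (d i x)" and ?k1 = "\<lambda>x. kl_normal r \<mu> (t i x) (d i x)"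
  \<comment> \<open>at most \<open>0\<close> where the noise exceeds \<open>K\<close> in absolute value\<close>
  let ?f = "\<lambda>u. w1 * \<kappa> * (1 - (u - \<mu>)\<^sup>2 / K\<^sup>2)"
  have hb: "has_bochner_integral lborel (\<lambda>u. normal_density \<mu> 1 u * ?f u) (w1 * spike_gain r \<mu> \<tau> K)"
    using normal_quadratic_expectation[of 1 \<mu> "w1 * \<kappa>" 0 "- (w1 * \<kappa> / K\<^sup>2)"]
    unfolding spike_gain_def \<kappa>_def[symmetric] by (simp add: right_diff_distrib mult.assoc)
  have "ennreal (w1 * spike_gain r \<mu> \<tau> K) \<le> (\<integral>\<^sup>+ u. ennreal (normal_density \<mu> 1 u * ?f u) \<partial>lborel)"
    by (rule ennreal_le_nn_integral[OF hb])
  also have "\<dots> = (\<integral>\<^sup>+ u. ennreal (?f u) * ennreal (normal_density ((\<theta>(i := \<mu>)) i) (sqrt 1) u) \<partial>lborel)"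
    by (rule nn_integral_cong) (simp add: ennreal_mult'[symmetric] ennreal_mult''[symmetric] mult.commute)
  also have "\<dots> = (\<integral>\<^sup>+ x. ennreal (?f (x i)) * ennreal (?\<phi>1 x) \<partial>Rn n)"
    by (rule nn_integral_gauss_marginal[OF i, symmetric]) auto
  also have "\<dots> \<le> (\<integral>\<^sup>+ x. ennreal w0 * (ennreal (?k0 x) * ennreal (?\<phi>0 x)) +
      ennreal w1 * (ennreal (?k1 x) * ennreal (?\<phi>1 x)) \<partial>Rn n)"
  proof (rule nn_integral_mono)
    fix x assume x: "x \<in> space (Rn n)"
    have k: "0 \<le> ?k0 x" "0 \<le> ?k1 x" using kl_normal_nonneg[OF r d[OF x]] by auto
    have \<phi>: "0 < ?\<phi>0 x" "0 < ?\<phi>1 x" by (auto intro: gauss_density_pos)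
    have "?f (x i) * ?\<phi>1 x \<le> w0 * (?k0 x * ?\<phi>0 x) + w1 * (?k1 x * ?\<phi>1 x)"
    proof (cases "x i \<le> \<mu> + K")
      case True
      have "w1 * ?\<phi>1 x = (w1 * exp (\<mu> * x i - \<mu>\<^sup>2 / 2)) * ?\<phi>0 x"
        using gauss_density_shift_coordinate[of i n \<theta> \<mu> x] i \<theta> by simp
      also have "\<dots> \<le> (w1 * exp (\<mu>\<^sup>2 / 2 + K * \<mu>)) * ?\<phi>0 x"
      proof -
        have "\<mu> * x i \<le> \<mu> * (\<mu> + K)" using True \<mu> by (rule mult_left_mono)
        then have "\<mu> * x i - \<mu>\<^sup>2 / 2 \<le> \<mu>\<^sup>2 / 2 + K * \<mu>"
          by (simp add: power2_eq_square algebra_simps)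
        then show ?thesis using w \<phi> by (intro mult_right_mono mult_left_mono) auto
      qed
      also have "\<dots> \<le> (\<tau> * w0) * ?\<phi>0 x" using \<tau> \<phi> by (intro mult_right_mono) auto
      finally have "w1 * ?\<phi>1 x \<le> \<tau> * (w0 * ?\<phi>0 x)" by (simp add: mult.assoc)
      from kl_normal_two_point[OF r d[OF x] _ _ this] w \<phi>
      have "(w1 * ?\<phi>1 x) * \<kappa> \<le> (w1 * ?\<phi>1 x) * ?k1 x + (w0 * ?\<phi>0 x) * ?k0 x"
        unfolding \<kappa>_def by simp
      moreover have "?f (x i) * ?\<phi>1 x \<le> (w1 * ?\<phi>1 x) * \<kappa>"
      proof -
        have "(w1 * ?\<phi>1 x * \<kappa>) * (1 - (x i - \<mu>)\<^sup>2 / K\<^sup>2) \<le> (w1 * ?\<phi>1 x * \<kappa>) * 1"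
          using w \<phi> \<kappa> by (intro mult_left_mono) auto
        then show ?thesis by (simp add: mult_ac)
      qed
      ultimately show ?thesis by (simp add: mult_ac)
    next
      case False
      then have "K\<^sup>2 \<le> (x i - \<mu>)\<^sup>2" using K by (intro power_mono) auto
      then have "1 - (x i - \<mu>)\<^sup>2 / K\<^sup>2 \<le> 0" using K by simp
      then have "?f (x i) * ?\<phi>1 x \<le> 0"
        using w \<kappa> \<phi> by (simp add: mult_nonneg_nonpos mult_nonpos_nonneg)
      also have "\<dots> \<le> w0 * (?k0 x * ?\<phi>0 x) + w1 * (?k1 x * ?\<phi>1 x)" using w k \<phi> by simp
      finally show ?thesis .
    qed
    from ennreal_leI[OF this]
    show "ennreal (?f (x i)) * ennreal (?\<phi>1 x) \<le> ennreal w0 * (ennreal (?k0 x) * ennreal (?\<phi>0 x)) +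
      ennreal w1 * (ennreal (?k1 x) * ennreal (?\<phi>1 x))"
      using w k \<phi> by (simp add: ennreal_mult'' ennreal_mult' ennreal_plus)
  qed
  also have "\<dots> = ennreal w0 * coord_risk n r t d i \<theta> + ennreal w1 * coord_risk n r t d i (\<theta>(i := \<mu>))"
    unfolding coord_risk_def \<theta> by (simp add: nn_integral_add nn_integral_cmult)
  finally show ?thesis .
qed

text \<open>
  Averaging over a product prior can be done one coordinate at a time: a lower bound on the average
  over component \<open>b\<close>, valid for all values of the other components, bounds the total average.
\<close>

lemma sum_PiE_resample:
  fixes w :: "'b \<Rightarrow> ennreal"
  assumes "finite I" "finite J" "b \<in> I" and w: "(\<Sum>j\<in>J. w j) = 1"
    and le: "\<And>c. c \<in> (I - {b}) \<rightarrow>\<^sub>E J \<Longrightarrow> C \<le> (\<Sum>j\<in>J. w j * G (c(b := j)))"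
  shows "C \<le> (\<Sum>c\<in>I \<rightarrow>\<^sub>E J. (\<Prod>i\<in>I. w (c i)) * G c)"
proof -
  let ?I = "I - {b}"
  have I: "I = insert b ?I" using \<open>b \<in> I\<close> by auto
  have total: "(\<Sum>c\<in>?I \<rightarrow>\<^sub>E J. \<Prod>i\<in>?I. w (c i)) = 1"
    using prod_sum_PiE[of ?I "\<lambda>_. J" "\<lambda>_. w"] assms by simp
  have "C = (\<Sum>c\<in>?I \<rightarrow>\<^sub>E J. (\<Prod>i\<in>?I. w (c i)) * C)"
    unfolding sum_distrib_right[symmetric] total by simp
  also have "\<dots> \<le> (\<Sum>c\<in>?I \<rightarrow>\<^sub>E J. (\<Prod>i\<in>?I. w (c i)) * (\<Sum>j\<in>J. w j * G (c(b := j))))"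
    by (intro sum_mono mult_left_mono le) auto
  also have "\<dots> = (\<Sum>(j, c)\<in>J \<times> (?I \<rightarrow>\<^sub>E J). (\<Prod>i\<in>I. w ((c(b := j)) i)) * G (c(b := j)))"
  proof -
    have "(\<Prod>i\<in>?I. w (c i)) * (w j * G (c(b := j))) = (\<Prod>i\<in>I. w ((c(b := j)) i)) * G (c(b := j))" for c j
    proof -
      have "(\<Prod>i\<in>I. w ((c(b := j)) i)) = w j * (\<Prod>i\<in>?I. w (c i))"
        using assms by (subst prod.remove[of _ b]) (auto intro!: prod.cong)
      then show ?thesis by (simp add: mult_ac)
    qed
    then show ?thesis
      by (simp add: sum_distrib_left sum.cartesian_product[symmetric]) (rule sum.swap)
  qed
  also have "\<dots> = (\<Sum>c\<in>(\<lambda>(j, c). c(b := j)) ` (J \<times> (?I \<rightarrow>\<^sub>E J)). (\<Prod>i\<in>I. w (c i)) * G c)"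
    by (subst sum.reindex) (use inj_combinator[of b ?I "\<lambda>_. J"] in \<open>auto simp: case_prod_unfold o_def\<close>)
  also have "(\<lambda>(j, c). c(b := j)) ` (J \<times> (?I \<rightarrow>\<^sub>E J)) = I \<rightarrow>\<^sub>E J"
    by (subst (2) I, subst PiE_insert_eq) simp
  finally show ?thesis .
qed

text \<open>
  Block \<open>b\<close> consists of the coordinates \<open>b * m + k\<close> with \<open>k < m\<close>, and \<open>c b\<close> is the position of its
  spike. The value \<open>c b = m\<close>, which is never a remainder modulo \<open>m > 0\<close>, encodes an empty block.
\<close>

definition block_spikes :: "nat \<Rightarrow> nat \<Rightarrow> nat \<Rightarrow> real \<Rightarrow> (nat \<Rightarrow> nat) \<Rightarrow> nat \<Rightarrow> real" where
  "block_spikes n s m \<mu> c = (\<lambda>i\<in>{..<n}. if i div m < s \<and> c (i div m) = i mod m then \<mu> else 0)"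

lemma block_spikes_in_sparse_space: "block_spikes n s m \<mu> c \<in> sparse_space n s"
proof -
  have "{i \<in> {..<n}. block_spikes n s m \<mu> c i \<noteq> 0} \<subseteq> (\<lambda>b. b * m + c b) ` {..<s}"
  proof
    fix i assume "i \<in> {i \<in> {..<n}. block_spikes n s m \<mu> c i \<noteq> 0}"
    then have "i div m < s" "c (i div m) = i mod m"
      by (auto simp: block_spikes_def split: if_splits)
    then show "i \<in> (\<lambda>b. b * m + c b) ` {..<s}"
      by (intro image_eqI[of _ _ "i div m"]) auto
  qed
  then have "card {i \<in> {..<n}. block_spikes n s m \<mu> c i \<noteq> 0} \<le> s"
    using surj_card_le[of "{..<s}"] by fastforce
  then show ?thesis by (simp add: sparse_space_def Rn_def space_PiM block_spikes_def)
qed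

lemma block_spikes_update:
  assumes "b < s" "k < m" "s * m \<le> n"
  shows "block_spikes n s m \<mu> (c(b := k)) = (block_spikes n s m \<mu> (c(b := m)))(b * m + k := \<mu>)"
    and "block_spikes n s m \<mu> (c(b := m)) (b * m + k) = 0"
proof -
  have n: "b * m + k < n"
  proof -
    have "b * m + k < Suc b * m" using assms by simp
    also have "\<dots> \<le> s * m" using assms by (intro mult_right_mono) auto
    finally show ?thesis using assms by simp
  qed
  have *: "(b * m + k) div m = b" "(b * m + k) mod m = k" using assms by auto
  show "block_spikes n s m \<mu> (c(b := m)) (b * m + k) = 0"
    using assms * n by (simp add: block_spikes_def)
  show "block_spikes n s m \<mu> (c(b := k)) = (block_spikes n s m \<mu> (c(b := m)))(b * m + k := \<mu>)"
  proof
    fix i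
    have i: "i mod m \<noteq> m" using assms by (metis less_irrefl mod_less_divisor not_less_zero neq0_conv)
    show "block_spikes n s m \<mu> (c(b := k)) i = ((block_spikes n s m \<mu> (c(b := m)))(b * m + k := \<mu>)) i"
    proof (cases "i = b * m + k")
      case True
      then show ?thesis using assms * n by (simp add: block_spikes_def)
    next
      case False
      then have "\<not> (i div m = b \<and> i mod m = k)" by (metis div_mult_mod_eq)
      then show ?thesis using False i by (cases "i div m = b") (auto simp: block_spikes_def restrict_def)
    qed
  qed
qed

lemma sum_over_blocks_le:
  fixes f :: "nat \<Rightarrow> ennreal"
  assumes "s * m \<le> n"
  shows "(\<Sum>b<s. \<Sum>k<m. f (b * m + k)) \<le> (\<Sum>i<n. f i)"
proof -
  have "(\<Sum>b<s. \<Sum>k<m. f (b * m + k)) = (\<Sum>i<s * m. f i)"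
    by (subst sum.nat_group[symmetric], subst sum.atLeastLessThan_shift_0) (simp add: lessThan_atLeast0 o_def)
  also have "\<dots> \<le> (\<Sum>i<n. f i)" using assms by (intro sum_mono2) auto
  finally show ?thesis .
qed

text \<open>
  The supremum of the risk dominates its average under the prior that chooses each block
  independently, empty with probability \<open>\<delta>\<close> and with a spike at each of the \<open>m\<close> positions with
  probability \<open>(1 - \<delta>) / m\<close>. Within a block, the risk at an empty block is spread over all positions,
  and a spike at position \<open>k\<close> is charged only for coordinate \<open>k\<close>.
\<close>

lemma R_G_ge_block_prior:
  assumes r: "0 < r" and m: "0 < m" and sm: "s * m \<le> n"
    and \<delta>: "0 < \<delta>" "\<delta> < 1" and K: "1 \<le> K" and \<mu>: "0 \<le> \<mu>"
    and \<tau>: "(1 - \<delta>) / real m * exp (\<mu>\<^sup>2 / 2 + K * \<mu>) \<le> \<tau> * \<delta>"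
  shows "ereal (real s * ((1 - \<delta>) * spike_gain r \<mu> \<tau> K)) \<le> R_G r n (sparse_space n s)"
  unfolding minimax_risk_def
proof (rule INF_greatest)
  fix p assume "p \<in> gaussian_estimators n"
  then obtain t d where t [measurable]: "\<And>i. i < n \<Longrightarrow> t i \<in> borel_measurable (Rn n)"
    and d [measurable]: "\<And>i. i < n \<Longrightarrow> d i \<in> borel_measurable (Rn n)"
    and d0: "\<And>i x. i < n \<Longrightarrow> x \<in> space (Rn n) \<Longrightarrow> 0 < d i x"
    and p: "\<And>x y. x \<in> space (Rn n) \<Longrightarrow> y \<in> space (Rn n) \<Longrightarrow>
      p x y = prod_normal_density n (\<lambda>i. t i x) (\<lambda>i. d i x) y"
    unfolding gaussian_estimators_def mem_Collect_eq by blast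
  let ?F = "coord_risk n r t d"
  have risk: "kl_risk n r \<theta> p = enn2ereal (\<Sum>i<n. ?F i \<theta>)" for \<theta>
  proof -
    have "kl_risk n r \<theta> p = enn2ereal (\<integral>\<^sup>+ x. (\<Sum>i<n. ennreal (kl_normal r (\<theta> i) (t i x) (d i x)))
       * ennreal (gauss_density n \<theta> 1 x) \<partial>Rn n)"
      by (rule kl_risk_prod_normal[OF r _ p]) (use d0 in auto)
    then show ?thesis
      unfolding sum_distrib_right coord_risk_def by (subst (asm) nn_integral_sum) auto
  qed
  define S where "S = (SUP \<theta>\<in>sparse_space n s. kl_risk n r \<theta> p)"
  define S' where "S' = e2ennreal S"
  have "0 \<le> kl_risk n r (\<lambda>i\<in>{..<n}. 0) p" unfolding risk by simp
  also have "\<dots> \<le> S" unfolding S_def by (rule SUP_upper[OF zero_in_sparse_space])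
  finally have S: "S = enn2ereal S'" by (simp add: S'_def enn2ereal_e2ennreal)
  have le_S': "(\<Sum>i<n. ?F i (block_spikes n s m \<mu> c)) \<le> S'" for c
  proof -
    have "kl_risk n r (block_spikes n s m \<mu> c) p \<le> S"
      unfolding S_def by (rule SUP_upper[OF block_spikes_in_sparse_space])
    then show ?thesis unfolding S risk less_eq_ennreal.rep_eq .
  qed
  define w where "w j = ennreal (if j = m then \<delta> else (1 - \<delta>) / real m)" for j
  let ?J = "{..m}" and ?I = "{..<s}"
  have w_sum: "(\<Sum>j\<in>?J. w j) = 1"
  proof -
    have "(\<Sum>j\<in>?J. w j) = (\<Sum>j<m. ennreal ((1 - \<delta>) / real m)) + ennreal \<delta>"
      unfolding w_def lessThan_Suc_atMost[symmetric] by simp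
    also have "\<dots> = ennreal (1 - \<delta>) + ennreal \<delta>"
      using m \<delta> by (simp add: ennreal_of_nat_eq_real_of_nat ennreal_mult[symmetric])
    also have "\<dots> = 1" using \<delta> by (simp add: ennreal_plus[symmetric] del: ennreal_plus)
    finally show ?thesis .
  qed
  define W where "W c = (\<Prod>i\<in>?I. w (c i))" for c
  have W_sum: "(\<Sum>c\<in>?I \<rightarrow>\<^sub>E ?J. W c) = 1"
    using prod_sum_PiE[of ?I "\<lambda>_. ?J" "\<lambda>_. w"] w_sum by (simp add: W_def)
  define C where "C = (1 - \<delta>) * spike_gain r \<mu> \<tau> K"
  have \<tau>0: "0 \<le> \<tau>"
  proof -
    have "0 \<le> (1 - \<delta>) / real m * exp (\<mu>\<^sup>2 / 2 + K * \<mu>)" using \<delta> by simp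
    from order_trans[OF this \<tau>] show ?thesis using \<delta> by (simp add: zero_le_mult_iff)
  qed
  have gain0: "0 \<le> spike_gain r \<mu> \<tau> K"
    using K \<tau>0 r by (auto simp: spike_gain_def intro!: mult_nonneg_nonneg)
  have block: "ennreal C \<le> (\<Sum>c\<in>?I \<rightarrow>\<^sub>E ?J. W c * (\<Sum>k<m. ?F (b * m + k) (block_spikes n s m \<mu> c)))"
    if b: "b < s" for b
    unfolding W_def
  proof (rule sum_PiE_resample[where b = b])
    fix c
    let ?\<theta> = "\<lambda>j. block_spikes n s m \<mu> (c(b := j))"
    have "ennreal C = (\<Sum>k<m. ennreal ((1 - \<delta>) / real m * spike_gain r \<mu> \<tau> K))"
      using m \<delta> gain0 by (simp add: C_def ennreal_of_nat_eq_real_of_nat ennreal_mult[symmetric])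
    also have "\<dots> \<le> (\<Sum>k<m. w m * ?F (b * m + k) (?\<theta> m) + w k * ?F (b * m + k) (?\<theta> k))"
    proof (rule sum_mono)
      fix k assume "k \<in> {..<m}"
      then have k: "k < m" by simp
      have i: "b * m + k < n"
      proof -
        have "b * m + k < Suc b * m" using k by simp
        also have "\<dots> \<le> s * m" using b by (intro mult_right_mono) auto
        finally show ?thesis using sm by simp
      qed
      have wk: "w m = ennreal \<delta>" "w k = ennreal ((1 - \<delta>) / real m)" using k by (auto simp: w_def)
      show "ennreal ((1 - \<delta>) / real m * spike_gain r \<mu> \<tau> K)
        \<le> w m * ?F (b * m + k) (?\<theta> m) + w k * ?F (b * m + k) (?\<theta> k)"
        unfolding wk block_spikes_update(1)[OF b k sm]
        by (rule coord_risk_spike_or_zero)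
          (use r i block_spikes_update(2)[OF b k sm] t d d0 \<delta> m K \<mu> \<tau> in auto)
    qed
    also have "\<dots> = w m * (\<Sum>k<m. ?F (b * m + k) (?\<theta> m)) + (\<Sum>k<m. w k * ?F (b * m + k) (?\<theta> k))"
      by (simp add: sum.distrib sum_distrib_left)
    also have "\<dots> \<le> w m * (\<Sum>k<m. ?F (b * m + k) (?\<theta> m)) +
        (\<Sum>j<m. w j * (\<Sum>k<m. ?F (b * m + k) (?\<theta> j)))"
      by (intro add_left_mono sum_mono mult_left_mono member_le_sum) auto
    also have "\<dots> = (\<Sum>j\<in>?J. w j * (\<Sum>k<m. ?F (b * m + k) (?\<theta> j)))"
      unfolding lessThan_Suc_atMost[symmetric] by (simp add: add.commute)
    finally show "ennreal C \<le> (\<Sum>j\<in>?J. w j * (\<Sum>k<m. ?F (b * m + k) (?\<theta> j)))" .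
  qed (use b w_sum in auto)
  have "ennreal (real s * C) = (\<Sum>b<s. ennreal C)"
    using \<delta> gain0 by (simp add: C_def ennreal_of_nat_eq_real_of_nat ennreal_mult[symmetric])
  also have "\<dots> \<le> (\<Sum>b<s. \<Sum>c\<in>?I \<rightarrow>\<^sub>E ?J. W c * (\<Sum>k<m. ?F (b * m + k) (block_spikes n s m \<mu> c)))"
    by (intro sum_mono block) simp
  also have "\<dots> = (\<Sum>c\<in>?I \<rightarrow>\<^sub>E ?J. W c * (\<Sum>b<s. \<Sum>k<m. ?F (b * m + k) (block_spikes n s m \<mu> c)))"
    by (subst sum.swap) (simp add: sum_distrib_left)
  also have "\<dots> \<le> (\<Sum>c\<in>?I \<rightarrow>\<^sub>E ?J. W c * S')"
    by (intro sum_mono mult_left_mono order_trans[OF sum_over_blocks_le[OF sm] le_S']) auto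
  also have "\<dots> = S'" unfolding sum_distrib_right[symmetric] W_sum by simp
  finally have "enn2ereal (ennreal (real s * C)) \<le> S"
    unfolding S less_eq_ennreal.rep_eq .
  then show "ereal (real s * ((1 - \<delta>) * spike_gain r \<mu> \<tau> K)) \<le> (SUP \<theta>\<in>sparse_space n s. kl_risk n r \<theta> p)"
    using \<delta> gain0 by (simp add: S_def C_def enn2ereal_ennreal)
qed

section \<open>Positivity of the unrestricted minimax risk\<close>

lemma sigma_finite_Rn: "sigma_finite_measure (Rn n)"
proof -
  interpret product_sigma_finite "\<lambda>_::nat. lborel :: real measure" ..
  show ?thesis unfolding Rn_def by (rule sigma_finite) simp
qed

text \<open>
  From \<open>ln z \<le> z - 1\<close> at \<open>z = sqrt (q / g)\<close>.
\<close>

lemma kl_integrand_ge: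
  fixes g q :: real
  assumes g: "0 < g" and q: "0 < q"
  shows "g - q + (sqrt g - sqrt q)\<^sup>2 \<le> g * ln (g / q)"
proof -
  have "ln (sqrt (q / g)) \<le> sqrt (q / g) - 1" by (rule ln_le_minus_one) (use g q in simp)
  then have "- 2 * g * (sqrt (q / g) - 1) \<le> - 2 * g * ln (sqrt (q / g))"
    using g by (intro mult_left_mono_neg) auto
  also have "ln (sqrt (q / g)) = - (ln (g / q) / 2)"
    using g q by (simp add: ln_sqrt ln_div diff_divide_distrib)
  also have "- 2 * g * - (ln (g / q) / 2) = g * ln (g / q)" by simp
  also have "- 2 * g * (sqrt (q / g) - 1) = 2 * g - 2 * (sqrt g * sqrt q)"
  proof -
    have "g * sqrt (q / g) = sqrt g * sqrt q"
      using g q real_sqrt_mult_self[of g] by (simp add: real_sqrt_divide field_simps)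
    then show ?thesis by (simp add: algebra_simps)
  qed
  also have "\<dots> = g - q + (sqrt g - sqrt q)\<^sup>2" using g q by (simp add: power2_diff)
  finally show ?thesis .
qed

text \<open>
  Integrate \<open>kl_integrand_ge\<close>, where \<open>g\<close> and \<open>q\<close> have the same total mass. The Hellinger distance is
  preferred to the divergence itself because it is an integral of a nonnegative jointly measurable function, hence
  measurable in the observation.
\<close>

lemma kl_loss_ge_hellinger:
  assumes r: "0 < r" and q [measurable]: "q \<in> borel_measurable (Rn n)"
    and q0: "\<And>y. y \<in> space (Rn n) \<Longrightarrow> 0 \<le> q y" and q1: "(\<integral>\<^sup>+ y. ennreal (q y) \<partial>Rn n) = 1"
  shows "enn2ereal (\<integral>\<^sup>+ y. ennreal ((sqrt (gauss_density n \<theta> r y) - sqrt (q y))\<^sup>2) \<partial>Rn n)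
    \<le> kl_loss n r \<theta> q"
proof -
  let ?g = "gauss_density n \<theta> r"
  let ?h = "\<lambda>y. (sqrt (?g y) - sqrt (q y))\<^sup>2"
  define f where "f y = (if q y = 0 then \<infinity> else ereal (?g y * ln (?g y / q y)))" for y
  have [measurable]: "f \<in> borel_measurable (Rn n)" unfolding f_def by measurable
  define P where "P = (\<integral>\<^sup>+ y. e2ennreal (f y) \<partial>Rn n)"
  define N where "N = (\<integral>\<^sup>+ y. e2ennreal (- f y) \<partial>Rn n)"
  define H where "H = (\<integral>\<^sup>+ y. ennreal (?h y) \<partial>Rn n)"
  have pw: "e2ennreal (- f y) + ennreal (?g y) + ennreal (?h y) \<le> e2ennreal (f y) + ennreal (q y)"
    and neg: "e2ennreal (- f y) \<le> ennreal (q y)" if y: "y \<in> space (Rn n)" for y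
  proof -
    have "(e2ennreal (- f y) + ennreal (?g y) + ennreal (?h y) \<le> e2ennreal (f y) + ennreal (q y)) \<and>
      e2ennreal (- f y) \<le> ennreal (q y)"
    proof (cases "q y = 0")
      case True
      then show ?thesis by (simp add: f_def e2ennreal_neg)
    next
      case False
      then have qp: "0 < q y" using q0[OF y] by simp
      have gp: "0 < ?g y" by (rule gauss_density_pos[OF r])
      let ?a = "?g y * ln (?g y / q y)"
      have ge: "?g y - q y + ?h y \<le> ?a" by (rule kl_integrand_ge[OF gp qp])
      have f: "e2ennreal (f y) = ennreal ?a" "e2ennreal (- f y) = ennreal (- ?a)"
        using False by (simp_all add: f_def ennreal_def)
      show ?thesis
      proof (cases "0 \<le> ?a")
        case True
        have "ennreal (?g y) + ennreal (?h y) \<le> ennreal ?a + ennreal (q y)"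
          using ge True qp gp by (simp add: ennreal_plus[symmetric] ennreal_leI del: ennreal_plus)
        moreover have "ennreal (- ?a) = 0" using True by (simp add: ennreal_neg)
        ultimately show ?thesis unfolding f by simp
      next
        case False
        define b where "b = - ?a"
        have b: "0 \<le> b" "b + ?g y + ?h y \<le> q y" using False ge by (auto simp: b_def)
        have "ennreal b + ennreal (?g y) + ennreal (?h y) = ennreal (b + ?g y + ?h y)"
          using b gp by (simp add: ennreal_plus)
        then have "ennreal (- ?a) + ennreal (?g y) + ennreal (?h y) \<le> ennreal (q y)"
          unfolding b_def[symmetric] using b(2) by (simp only: ennreal_leI)
        moreover have "ennreal (- ?a) \<le> ennreal (q y)"
        proof (rule ennreal_leI)
          have "0 \<le> ?h y" by simp
          then show "- ?a \<le> q y" using b gp unfolding b_def by linarith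
        qed
        ultimately show ?thesis unfolding f by (auto intro: add_increasing)
      qed
    qed
    then show "e2ennreal (- f y) + ennreal (?g y) + ennreal (?h y) \<le> e2ennreal (f y) + ennreal (q y)"
      "e2ennreal (- f y) \<le> ennreal (q y)" by auto
  qed
  have "N \<le> 1" unfolding N_def q1[symmetric] by (rule nn_integral_mono) (rule neg)
  then have N: "N \<noteq> \<infinity>" by (auto simp: top_unique)
  have "N + 1 + H \<le> P + 1"
  proof -
    have "N + 1 + H = (\<integral>\<^sup>+ y. e2ennreal (- f y) + ennreal (?g y) + ennreal (?h y) \<partial>Rn n)"
      unfolding N_def H_def by (simp add: nn_integral_add nn_integral_gauss_density[OF r])
    also have "\<dots> \<le> (\<integral>\<^sup>+ y. e2ennreal (f y) + ennreal (q y) \<partial>Rn n)"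
      by (rule nn_integral_mono) (rule pw)
    also have "\<dots> = P + 1" unfolding P_def by (simp add: nn_integral_add q1)
    finally show ?thesis .
  qed
  then have "1 + (N + H) \<le> 1 + P" by (simp add: add_ac)
  then have "N + H \<le> P" by (subst (asm) ennreal_add_left_cancel_le) auto
  then have "enn2ereal N + enn2ereal H \<le> enn2ereal P"
    by (simp add: less_eq_ennreal.rep_eq plus_ennreal.rep_eq)
  moreover have "\<bar>enn2ereal N\<bar> \<noteq> \<infinity>" using N by (cases N) (auto simp: enn2ereal_ennreal)
  ultimately have "enn2ereal H \<le> enn2ereal P - enn2ereal N"
    by (simp add: ereal_le_minus add.commute)
  then show ?thesis
    unfolding kl_loss_def ereal_integral_def H_def P_def N_def f_def .
qed

lemma kl_risk_ge_hellinger: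
  assumes r: "0 < r" and p: "p \<in> all_estimators n"
  shows "enn2ereal (\<integral>\<^sup>+ x. (\<integral>\<^sup>+ y. ennreal ((sqrt (gauss_density n \<theta> r y) - sqrt (p x y))\<^sup>2) \<partial>Rn n)
      * ennreal (gauss_density n \<theta> 1 x) \<partial>Rn n) \<le> kl_risk n r \<theta> p"
proof -
  have pm: "(\<lambda>(x, y). p x y) \<in> borel_measurable (Rn n \<Otimes>\<^sub>M Rn n)"
    using p by (simp add: all_estimators_def)
  let ?H = "\<lambda>x. \<integral>\<^sup>+ y. ennreal ((sqrt (gauss_density n \<theta> r y) - sqrt (p x y))\<^sup>2) \<partial>Rn n"
  have le: "enn2ereal (?H x) \<le> kl_loss n r \<theta> (p x)" if x: "x \<in> space (Rn n)" for x
  proof (rule kl_loss_ge_hellinger[OF r])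
    show "p x \<in> borel_measurable (Rn n)"
      using measurable_compose[OF measurable_Pair1'[OF x] pm] by simp
  qed (use p x in \<open>auto simp: all_estimators_def\<close>)
  have nonneg: "0 \<le> kl_loss n r \<theta> (p x)" if "x \<in> space (Rn n)" for x
    using le[OF that] by (rule order_trans[rotated]) simp
  have "(\<integral>\<^sup>+ x. ?H x * ennreal (gauss_density n \<theta> 1 x) \<partial>Rn n)
    \<le> (\<integral>\<^sup>+ x. e2ennreal (kl_loss n r \<theta> (p x) * ereal (gauss_density n \<theta> 1 x)) \<partial>Rn n)"
  proof (rule nn_integral_mono)
    fix x assume x: "x \<in> space (Rn n)"
    have "enn2ereal (?H x * ennreal (gauss_density n \<theta> 1 x))
        = enn2ereal (?H x) * ereal (gauss_density n \<theta> 1 x)"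
      unfolding times_ennreal.rep_eq by (subst enn2ereal_ennreal) simp_all
    from arg_cong[OF this, of e2ennreal]
    have "?H x * ennreal (gauss_density n \<theta> 1 x)
        = e2ennreal (enn2ereal (?H x) * ereal (gauss_density n \<theta> 1 x))"
      unfolding e2ennreal_enn2ereal .
    also have "\<dots> \<le> e2ennreal (kl_loss n r \<theta> (p x) * ereal (gauss_density n \<theta> 1 x))"
      by (intro e2ennreal_mono ereal_mult_right_mono le x) simp
    finally show "?H x * ennreal (gauss_density n \<theta> 1 x)
      \<le> e2ennreal (kl_loss n r \<theta> (p x) * ereal (gauss_density n \<theta> 1 x))" .
  qed
  then show ?thesis
    unfolding kl_risk_def less_eq_ennreal.rep_eq
    by (subst ereal_integral_nonneg_ereal) (auto intro: nonneg ereal_0_le_mult)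
qed

lemma gauss_density_mean:
  assumes "i < n" "0 < v"
  shows "has_bochner_integral (Rn n) (\<lambda>x. gauss_density n \<theta> v x * x i) (\<theta> i)"
proof (rule has_bochner_integral_gauss_marginal[OF assms])
  show "has_bochner_integral lborel (\<lambda>u. normal_density (\<theta> i) (sqrt v) u * u) (\<theta> i)"
    using normal_moment_nz_1[of "sqrt v" "\<theta> i"] assms by simp
qed

text \<open>
  No density can be close to the true one both for \<open>\<theta> = 0\<close> and for a unit vector: the
  two squared Hellinger distances add up to at least half the squared distance of the two true densities. Since the
  laws of the observation overlap, the sum of the two risks has a positive lower bound that is
  the same for all estimators.
\<close>

lemma R_N_pos:
  assumes r: "0 < r" and s: "0 < s" "s \<le> n"
  shows "0 < R_N r n (sparse_space n s)"
proof -
  have n: "0 < n" using s by simp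
  define \<theta>0 :: "nat \<Rightarrow> real" where "\<theta>0 = (\<lambda>i\<in>{..<n}. 0)"
  define \<theta>1 :: "nat \<Rightarrow> real" where "\<theta>1 = (\<lambda>i\<in>{..<n}. if i = 0 then 1 else 0)"
  have in_space: "\<theta>0 \<in> sparse_space n s" "\<theta>1 \<in> sparse_space n s"
    unfolding \<theta>0_def \<theta>1_def using zero_in_sparse_space single_spike_in_sparse_space[OF s(1)] by auto
  let ?g0 = "gauss_density n \<theta>0 r" and ?g1 = "gauss_density n \<theta>1 r"
  let ?\<phi>0 = "gauss_density n \<theta>0 1" and ?\<phi>1 = "gauss_density n \<theta>1 1"
  define c where "c = (\<integral>\<^sup>+ y. ennreal ((sqrt (?g0 y) - sqrt (?g1 y))\<^sup>2 / 2) \<partial>Rn n)"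
  define D where "D = (\<integral>\<^sup>+ x. ennreal (min (?\<phi>0 x) (?\<phi>1 x)) \<partial>Rn n)"
  have "c \<noteq> 0"
  proof
    assume "c = 0"
    then have "AE y in Rn n. ennreal ((sqrt (?g0 y) - sqrt (?g1 y))\<^sup>2 / 2) = 0"
      unfolding c_def by (subst (asm) nn_integral_0_iff_AE) auto
    then have ae: "AE y in Rn n. ?g0 y * y 0 = ?g1 y * y 0"
    proof eventually_elim
      case (elim y)
      then have "(sqrt (?g0 y) - sqrt (?g1 y))\<^sup>2 / 2 \<le> 0" by (simp only: ennreal_eq_0_iff)
      then have "sqrt (?g0 y) = sqrt (?g1 y)" by simp
      then show ?case by simp
    qed
    have "\<theta>0 0 = integral\<^sup>L (Rn n) (\<lambda>y. ?g0 y * y 0)" "\<theta>1 0 = integral\<^sup>L (Rn n) (\<lambda>y. ?g1 y * y 0)"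
      using gauss_density_mean[OF n r] by (simp_all add: has_bochner_integral_iff)
    moreover have "integral\<^sup>L (Rn n) (\<lambda>y. ?g0 y * y 0) = integral\<^sup>L (Rn n) (\<lambda>y. ?g1 y * y 0)"
      using ae n by (intro integral_cong_AE) auto
    ultimately show False using n by (simp add: \<theta>0_def \<theta>1_def)
  qed
  moreover have "D \<noteq> 0"
  proof
    assume "D = 0"
    then have "AE x in Rn n. ennreal (min (?\<phi>0 x) (?\<phi>1 x)) = 0"
      unfolding D_def by (subst (asm) nn_integral_0_iff_AE) auto
    then have "AE x in Rn n. ennreal (?\<phi>0 x) = 0"
    proof eventually_elim
      case (elim x)
      have "0 < min (?\<phi>0 x) (?\<phi>1 x)" by (simp add: gauss_density_pos)
      with elim show ?case by (simp add: ennreal_eq_0_iff)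
    qed
    then have "(\<integral>\<^sup>+ x. ennreal (?\<phi>0 x) \<partial>Rn n) = 0" by (subst nn_integral_0_iff_AE) auto
    then show False using nn_integral_gauss_density[of 1 n \<theta>0] by simp
  qed
  ultimately have pos: "0 < ennreal (1 / 2) * (c * D)"
    by (simp add: ennreal_zero_less_mult_iff zero_less_iff_neq_zero)
  have "enn2ereal (ennreal (1 / 2) * (c * D)) \<le> R_N r n (sparse_space n s)"
    unfolding minimax_risk_def
  proof (rule INF_greatest)
    fix p assume p: "p \<in> all_estimators n"
    then have pm [measurable]: "(\<lambda>(x, y). p x y) \<in> borel_measurable (Rn n \<Otimes>\<^sub>M Rn n)"
      by (simp add: all_estimators_def)
    let ?H = "\<lambda>\<theta> x. \<integral>\<^sup>+ y. ennreal ((sqrt (gauss_density n \<theta> r y) - sqrt (p x y))\<^sup>2) \<partial>Rn n"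
    interpret sigma_finite_measure "Rn n" by (rule sigma_finite_Rn)
    have Hm [measurable]: "?H \<theta> \<in> borel_measurable (Rn n)" for \<theta>
      by (rule borel_measurable_nn_integral) measurable
    define S where "S = (SUP \<theta>\<in>sparse_space n s. kl_risk n r \<theta> p)"
    have H_le: "enn2ereal (\<integral>\<^sup>+ x. ?H \<theta> x * ennreal (gauss_density n \<theta> 1 x) \<partial>Rn n) \<le> S"
      if "\<theta> \<in> sparse_space n s" for \<theta>
      unfolding S_def by (rule SUP_upper2[OF that]) (rule kl_risk_ge_hellinger[OF r p])
    have "0 \<le> S" using H_le[OF in_space(1)] by (rule order_trans[rotated]) simp
    then obtain S' where S: "S = enn2ereal S'" by (metis enn2ereal_e2ennreal)
    have "c * D = (\<integral>\<^sup>+ x. c * ennreal (min (?\<phi>0 x) (?\<phi>1 x)) \<partial>Rn n)"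
      unfolding D_def by (simp add: nn_integral_cmult)
    also have "\<dots> \<le> (\<integral>\<^sup>+ x. ?H \<theta>0 x * ennreal (?\<phi>0 x) + ?H \<theta>1 x * ennreal (?\<phi>1 x) \<partial>Rn n)"
    proof (rule nn_integral_mono)
      fix x assume x: "x \<in> space (Rn n)"
      have [measurable]: "p x \<in> borel_measurable (Rn n)"
        using measurable_compose[OF measurable_Pair1'[OF x] pm] by simp
      have "c \<le> (\<integral>\<^sup>+ y. ennreal ((sqrt (?g0 y) - sqrt (p x y))\<^sup>2) + ennreal ((sqrt (?g1 y) - sqrt (p x y))\<^sup>2) \<partial>Rn n)"
        unfolding c_def
      proof (rule nn_integral_mono)
        fix y
        have "(a - b)\<^sup>2 / 2 \<le> (a - q)\<^sup>2 + (b - q)\<^sup>2" for a b q :: real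
        proof -
          have "(a - q)\<^sup>2 + (b - q)\<^sup>2 - (a - b)\<^sup>2 / 2 = (a + b - 2 * q)\<^sup>2 / 2"
            by (simp add: power2_eq_square field_simps)
          moreover have "0 \<le> (a + b - 2 * q)\<^sup>2 / 2" by simp
          ultimately show ?thesis by linarith
        qed
        then show "ennreal ((sqrt (?g0 y) - sqrt (?g1 y))\<^sup>2 / 2)
          \<le> ennreal ((sqrt (?g0 y) - sqrt (p x y))\<^sup>2) + ennreal ((sqrt (?g1 y) - sqrt (p x y))\<^sup>2)"
          by (simp add: ennreal_plus[symmetric] ennreal_leI del: ennreal_plus)
      qed
      also have "\<dots> = ?H \<theta>0 x + ?H \<theta>1 x" by (rule nn_integral_add) measurable
      finally have "c * ennreal (min (?\<phi>0 x) (?\<phi>1 x)) \<le> (?H \<theta>0 x + ?H \<theta>1 x) * ennreal (min (?\<phi>0 x) (?\<phi>1 x))"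
        by (intro mult_right_mono) auto
      also have "\<dots> \<le> ?H \<theta>0 x * ennreal (?\<phi>0 x) + ?H \<theta>1 x * ennreal (?\<phi>1 x)"
        unfolding distrib_right by (intro add_mono mult_left_mono ennreal_leI) auto
      finally show "c * ennreal (min (?\<phi>0 x) (?\<phi>1 x))
        \<le> ?H \<theta>0 x * ennreal (?\<phi>0 x) + ?H \<theta>1 x * ennreal (?\<phi>1 x)" .
    qed
    also have "\<dots> = (\<integral>\<^sup>+ x. ?H \<theta>0 x * ennreal (?\<phi>0 x) \<partial>Rn n) + (\<integral>\<^sup>+ x. ?H \<theta>1 x * ennreal (?\<phi>1 x) \<partial>Rn n)"
      by (rule nn_integral_add) measurable
    also have "\<dots> \<le> S' + S'"
      using H_le[OF in_space(1)] H_le[OF in_space(2)] unfolding S less_eq_ennreal.rep_eq[symmetric]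
      by (rule add_mono)
    finally have "ennreal (1 / 2) * (c * D) \<le> ennreal (1 / 2) * (S' + S')"
      by (intro mult_left_mono) auto
    also have "\<dots> = ennreal (1 / 2) * 2 * S'" by (simp add: mult_2[symmetric] mult.assoc)
    also have "ennreal (1 / 2) * 2 = 1"
    proof -
      have "ennreal (1 / 2) * ennreal 2 = ennreal (1 / 2 * 2)" by (rule ennreal_mult[symmetric]) auto
      also have "\<dots> = 1" by simp
      finally show ?thesis by (simp only: ennreal_numeral)
    qed
    finally show "enn2ereal (ennreal (1 / 2) * (c * D)) \<le> (SUP \<theta>\<in>sparse_space n s. kl_risk n r \<theta> p)"
      unfolding S_def[symmetric] S less_eq_ennreal.rep_eq by simp
  qed
  moreover have "0 < enn2ereal (ennreal (1 / 2) * (c * D))"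
    using pos by (simp add: less_ennreal.rep_eq zero_ennreal.rep_eq)
  ultimately show ?thesis by (rule less_le_trans[rotated])
qed

section \<open>Asymptotics\<close>

text \<open>
  The lower bound per block with \<open>L = ln m\<close>. The spike height \<open>sqrt 2 * \<nu>\<close> is
  \<open>sqrt (2 L)\<close> lowered by a term of order \<open>L\<^bsup>1/4\<^esup>\<close>, so that \<open>\<nu>\<^sup>2 - L\<close> is about
  \<open>- 2 L\<^bsup>3/4\<^esup>\<close>. The truncation level \<open>K\<close>, of order \<open>L\<^bsup>1/8\<^esup>\<close>, tends to infinity and adds only
  a term of order \<open>L\<^bsup>5/8\<^esup>\<close> to the exponent; thus \<open>\<tau>\<close> tends to \<open>0\<close> faster than
  any power of \<open>L\<close>, in spite of the factor \<open>1 / \<delta> = L\<close>.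
\<close>

definition block_bound :: "real \<Rightarrow> real \<Rightarrow> real" where
  "block_bound r L = (let \<delta> = 1 / L; K = sqrt 2 * L powr (1/8); \<nu> = L powr (1/2) - L powr (1/4);
     \<tau> = (1 - \<delta>) * exp (- L) * exp (\<nu>\<^sup>2 + 2 * L powr (1/8) * \<nu>) / \<delta>
   in (1 - \<delta>) * spike_gain r (sqrt 2 * \<nu>) \<tau> K)"

lemma block_bound_asymptotics:
  assumes r: "0 < r"
  shows "((\<lambda>L. block_bound r L * r / L) \<longlongrightarrow> 1) at_top"
proof -
  define \<nu> where "\<nu> L = L powr (1/2) - L powr (1/4)" for L :: real
  define \<tau> where "\<tau> L = (1 - 1 / L) * exp (- L) * exp ((\<nu> L)\<^sup>2 + 2 * L powr (1/8) * \<nu> L) / (1 / L)"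
    for L :: real
  have "(\<tau> \<longlongrightarrow> 0) at_top" unfolding \<tau>_def \<nu>_def by real_asymp
  moreover have "((\<lambda>L. 2 * (\<nu> L)\<^sup>2 * \<tau> L) \<longlongrightarrow> 0) at_top" unfolding \<tau>_def \<nu>_def by real_asymp
  moreover have "((\<lambda>L. (1 - 1 / L) * ((\<nu> L)\<^sup>2 / L) * (1 - 1 / (2 * (L powr (1/8))\<^sup>2))) \<longlongrightarrow> 1) at_top"
    unfolding \<nu>_def by real_asymp
  ultimately have "((\<lambda>L. (1 - 1 / L) * ((\<nu> L)\<^sup>2 / L) * (1 - 1 / (2 * (L powr (1/8))\<^sup>2)) *
      (r / ((1 + \<tau> L) * (r + 2 * (\<nu> L)\<^sup>2 * \<tau> L)))) \<longlongrightarrow> 1 * (r / ((1 + 0) * (r + 0)))) at_top"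
    using r by (intro tendsto_intros) auto
  moreover have "(1 - 1 / L) * ((\<nu> L)\<^sup>2 / L) * (1 - 1 / (2 * (L powr (1/8))\<^sup>2)) *
      (r / ((1 + \<tau> L) * (r + 2 * (\<nu> L)\<^sup>2 * \<tau> L))) = block_bound r L * r / L" for L
  proof -
    have sq: "(sqrt 2 * x)\<^sup>2 = 2 * x\<^sup>2" for x :: real by (simp add: power_mult_distrib)
    show ?thesis
      unfolding block_bound_def Let_def \<nu>_def[symmetric] \<tau>_def[symmetric] spike_gain_def sq
        mult.assoc[of 2 "1 + \<tau> L"] mult_divide_mult_cancel_left[OF zero_neq_numeral[symmetric]]
      by (simp only: times_divide_eq_right times_divide_eq_left divide_divide_eq_left mult_ac)
  qed
  ultimately show ?thesis using r by simp
qed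

lemma R_G_ge_block_bound:
  assumes r: "0 < r" and s: "0 < s" and L: "1 < ln (real (n div s))"
  shows "ereal (real s * block_bound r (ln (real (n div s)))) \<le> R_G r n (sparse_space n s)"
proof -
  define m where "m = n div s"
  define L where "L = ln (real m)"
  define \<nu> where "\<nu> = L powr (1/2) - L powr (1/4)"
  have L1: "1 < L" using assms(3) by (simp add: L_def m_def)
  have m: "0 < m" using L1 by (cases "m = 0") (auto simp: L_def)
  have exp_L: "exp (- L) = 1 / real m" using m by (simp add: L_def exp_minus inverse_eq_divide)
  have sm: "s * m \<le> n" by (simp add: m_def)
  have "1 * 1 \<le> sqrt 2 * L powr (1/8)" using L1 by (intro mult_mono) (auto simp: ge_one_powr_ge_zero)
  then have K: "1 \<le> sqrt 2 * L powr (1/8)" by simp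
  have \<nu>: "0 \<le> sqrt 2 * \<nu>" using L1 by (simp add: \<nu>_def powr_mono)
  have eq: "(sqrt 2 * \<nu>)\<^sup>2 / 2 + sqrt 2 * L powr (1/8) * (sqrt 2 * \<nu>) = \<nu>\<^sup>2 + 2 * L powr (1/8) * \<nu>"
    using real_sqrt_mult_self[of 2] by (simp add: power_mult_distrib algebra_simps)
  show ?thesis
    unfolding m_def[symmetric] L_def[symmetric] block_bound_def Let_def \<nu>_def[symmetric]
    by (rule R_G_ge_block_prior[OF r m sm _ _ K \<nu>]) (use L1 in \<open>auto simp: eq exp_L\<close>)
qed

theorem proposition1:
  fixes r :: real and s :: "nat \<Rightarrow> nat"
  assumes "0 < r"
    and "\<And>n. 1 \<le> n \<Longrightarrow> 0 < s n"
    and "\<And>n. 1 \<le> n \<Longrightarrow> s n \<le> n"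
    and "(\<lambda>n. real (s n) / real n) \<longlonglongrightarrow> 0"
  shows "(\<forall>n\<ge>1. R_L r n (sparse_space n (s n)) = ereal (real n / 2 * ln (1 + inverse r)))
    \<and> filterlim (\<lambda>n. risk_ratio (R_L r n (sparse_space n (s n))) (R_N r n (sparse_space n (s n))))
        at_top sequentially
    \<and> (\<lambda>n. risk_ratio (R_G r n (sparse_space n (s n))) (R_E r n (sparse_space n (s n))))
        \<longlonglongrightarrow> 1"
proof (intro conjI)
  note r = assms(1)
  have R_L: "R_L r n (sparse_space n (s n)) = ereal (real n / 2 * ln (1 + inverse r))" if "1 \<le> n" for n
    by (rule R_L_sparse_space[OF r assms(2)[OF that]])
  then show "\<forall>n\<ge>1. R_L r n (sparse_space n (s n)) = ereal (real n / 2 * ln (1 + inverse r))" by blast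
  define X where "X n = real n / real (s n)" for n
  define m where "m n = n div s n" for n
  let ?U = "\<lambda>n. sparse_bound r n (s n)"
  define u where "u x = 2 + (1 + sqrt (2 * ln x))\<^sup>2" for x :: real
  have u_pos: "0 < u x" for x by (simp add: u_def add_pos_nonneg)
  have U_eq: "?U n = real (s n) / (2 * r) * u (X n)" for n
    by (simp add: sparse_bound_def X_def u_def)
  have X_top: "filterlim X at_top sequentially"
  proof -
    have "filterlim (\<lambda>n. real (s n) / real n) (at_right 0) sequentially"
      using assms(4) unfolding filterlim_at
      by (auto simp: eventually_sequentially intro!: exI[of _ 1] assms(2) divide_pos_pos)
    from filterlim_compose[OF filterlim_inverse_at_top_right this] show ?thesis
      by (simp add: X_def[abs_def] inverse_eq_divide)
  qed
  \<comment> \<open>Rounding \<open>n / s\<close> down to the block size is harmless, as only its logarithm matters.\<close>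
  have m_le: "real (m n) \<le> X n" and m_ge: "X n - 1 \<le> real (m n)" if n: "1 \<le> n" for n
  proof -
    have "m n * s n \<le> n" by (simp add: m_def)
    then have "real (m n) * real (s n) \<le> real n" by (metis of_nat_le_iff of_nat_mult)
    then show "real (m n) \<le> X n" using assms(2)[OF n] by (simp add: X_def pos_le_divide_eq)
    have "n \<le> (m n + 1) * s n"
      using assms(2)[OF n] dividend_less_div_times[of "s n" n] by (simp add: m_def)
    then have "real n \<le> (real (m n) + 1) * real (s n)"
      by (metis of_nat_1 of_nat_add of_nat_le_iff of_nat_mult)
    then show "X n - 1 \<le> real (m n)"
      using assms(2)[OF n] by (simp add: X_def pos_divide_le_eq algebra_simps)
  qed
  have m_top: "filterlim (\<lambda>n. real (m n)) at_top sequentially"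
  proof (rule filterlim_at_top_mono)
    show "filterlim (\<lambda>n. X n - 1) at_top sequentially"
      by (rule filterlim_compose[OF _ X_top]) real_asymp
    show "eventually (\<lambda>n. X n - 1 \<le> real (m n)) sequentially"
      using m_ge by (auto simp: eventually_sequentially)
  qed
  have lnm_top: "filterlim (\<lambda>n. ln (real (m n))) at_top sequentially"
    by (rule filterlim_compose[OF ln_at_top m_top])
  have ev: "eventually (\<lambda>n. 1 \<le> n \<and> 2 < X n \<and> 1 < ln (real (m n))) sequentially"
    by (intro eventually_conj eventually_ge_at_top
        filterlim_at_top_dense[THEN iffD1, OF X_top, rule_format]
        filterlim_at_top_dense[THEN iffD1, OF lnm_top, rule_format])

  show "filterlim (\<lambda>n. risk_ratio (R_L r n (sparse_space n (s n))) (R_N r n (sparse_space n (s n))))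
        at_top sequentially"
  proof (rule filterlim_at_top_mono)
    have "filterlim (\<lambda>x. x / u x) at_top at_top" unfolding u_def by real_asymp
    moreover have "0 < r * ln (1 + inverse r)" using r by (intro mult_pos_pos ln_gt_zero) auto
    ultimately have "filterlim (\<lambda>x. r * ln (1 + inverse r) * (x / u x)) at_top at_top"
      by (intro filterlim_tendsto_pos_mult_at_top[OF tendsto_const])
    then show "filterlim (\<lambda>n. r * ln (1 + inverse r) * (X n / u (X n))) at_top sequentially"
      by (rule filterlim_compose[OF _ X_top])
    show "eventually (\<lambda>n. r * ln (1 + inverse r) * (X n / u (X n)) \<le>
      risk_ratio (R_L r n (sparse_space n (s n))) (R_N r n (sparse_space n (s n)))) sequentially"
      using eventually_ge_at_top[of 1]
    proof eventually_elim
      case (elim n)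
      note s = assms(2)[OF elim] assms(3)[OF elim]
      have "0 < R_N r n (sparse_space n (s n))" "R_N r n (sparse_space n (s n)) \<le> ereal (?U n)"
        using R_N_pos[OF r s] minimax_le_sparse_bound(2)[OF r s] by auto
      then obtain \<rho> where \<rho>: "R_N r n (sparse_space n (s n)) = ereal \<rho>" "0 < \<rho>" "\<rho> \<le> ?U n"
        by (cases "R_N r n (sparse_space n (s n))") auto
      have "r * ln (1 + inverse r) * (X n / u (X n)) = (real n / 2 * ln (1 + inverse r)) / ?U n"
        unfolding U_eq X_def using r s by (simp add: field_simps)
      also have "\<dots> \<le> (real n / 2 * ln (1 + inverse r)) / \<rho>"
        using \<rho> r by (intro divide_left_mono) auto
      finally show ?case by (simp add: risk_ratio_def R_L[OF elim] \<rho>)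
    qed
  qed

  \<comment> \<open>The quotient \<open>s * block_bound r (ln m) / sparse_bound r n s\<close> of the two bounds, factored into three
     terms that each tend to \<open>1\<close>.\<close>
  let ?lower = "\<lambda>n. (block_bound r (ln (real (m n))) * r / ln (real (m n))) *
    (ln (real (m n)) / ln (X n)) * (2 * ln (X n) / u (X n))"
  have lnm_lnX: "(\<lambda>n. ln (real (m n)) / ln (X n)) \<longlonglongrightarrow> 1"
  proof (rule tendsto_sandwich[OF _ _ _ tendsto_const])
    show "(\<lambda>n. ln (X n - 1) / ln (X n)) \<longlonglongrightarrow> 1"
      by (rule filterlim_compose[OF _ X_top]) real_asymp
    show "eventually (\<lambda>n. ln (X n - 1) / ln (X n) \<le> ln (real (m n)) / ln (X n)) sequentially"
      using ev
    proof eventually_elim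
      case (elim n)
      then have "ln (X n - 1) \<le> ln (real (m n))" using m_ge[of n] by (subst ln_le_cancel_iff) auto
      then show ?case using elim by (intro divide_right_mono) auto
    qed
    show "eventually (\<lambda>n. ln (real (m n)) / ln (X n) \<le> 1) sequentially"
      using ev
    proof eventually_elim
      case (elim n)
      then have "0 < real (m n)" using m_ge[of n] by linarith
      then have "ln (real (m n)) \<le> ln (X n)" using m_le[of n] elim by simp
      then show ?case using elim by (simp add: pos_divide_le_eq)
    qed
  qed
  have lower: "?lower \<longlonglongrightarrow> 1"
  proof -
    have "(\<lambda>n. block_bound r (ln (real (m n))) * r / ln (real (m n))) \<longlonglongrightarrow> 1"
      by (rule filterlim_compose[OF block_bound_asymptotics[OF r] lnm_top])
    moreover have "((\<lambda>x. 2 * ln x / u x) \<longlongrightarrow> 1) at_top"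
      unfolding u_def by real_asymp (simp add: powr_half_sqrt)
    then have "(\<lambda>n. 2 * ln (X n) / u (X n)) \<longlonglongrightarrow> 1"
      by (rule filterlim_compose[OF _ X_top])
    ultimately show ?thesis using tendsto_mult[OF tendsto_mult[OF _ lnm_lnX]] by fastforce
  qed
  have lower_pos: "eventually (\<lambda>n. 0 < ?lower n) sequentially"
    using order_tendstoD(1)[OF lower, of 0] by simp
  have bounds: "eventually (\<lambda>n. ?lower n \<le> risk_ratio (R_G r n (sparse_space n (s n))) (R_E r n (sparse_space n (s n)))
      \<and> risk_ratio (R_G r n (sparse_space n (s n))) (R_E r n (sparse_space n (s n))) \<le> 1) sequentially"
    using ev lower_pos
  proof eventually_elim
    case (elim n)
    then have n: "1 \<le> n" and X: "2 < X n" and lnm: "1 < ln (real (m n))" by auto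
    note s = assms(2)[OF n] assms(3)[OF n]
    let ?G = "R_G r n (sparse_space n (s n))" and ?E = "R_E r n (sparse_space n (s n))"
    let ?b = "real (s n) * block_bound r (ln (real (m n)))"
    have lower_eq: "?lower n = ?b / ?U n"
      unfolding U_eq using r s lnm X by (simp add: field_simps)
    have U: "0 < ?U n" unfolding U_eq using r s u_pos by simp
    have b: "0 < ?b" using elim(2) U unfolding lower_eq by (simp add: zero_less_divide_iff)
    have "ereal ?b \<le> ?G" using R_G_ge_block_bound[OF r s(1)] lnm by (simp add: m_def)
    moreover have "?G \<le> ?E" by (rule R_G_le_R_E[OF r])
    moreover have "?E \<le> ereal (?U n)" by (rule minimax_le_sparse_bound(1)[OF r s])
    ultimately obtain g e where ge: "?G = ereal g" "?E = ereal e" "?b \<le> g" "g \<le> e" "e \<le> ?U n"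
      by (cases ?G; cases ?E) auto
    have "?b / ?U n \<le> g / e" using ge b by (intro frac_le) auto
    moreover have "g / e \<le> 1" using ge b by simp
    ultimately show ?case unfolding lower_eq by (simp add: risk_ratio_def ge)
  qed
  show "(\<lambda>n. risk_ratio (R_G r n (sparse_space n (s n))) (R_E r n (sparse_space n (s n)))) \<longlonglongrightarrow> 1"
    using bounds unfolding eventually_conj_iff
    by (blast intro: tendsto_sandwich[OF _ _ lower tendsto_const])
qed

end
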